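(* For all $n\ge 1$: $\widehat{wg}(n,1,1)=n-1$; $\widehat{wg}(n,2,1)=0$ if $n\le 2$ and $\widehat{wg}(n,2,1)=n^2-6n+9$ if $n\ge 3$; $\widehat{wg}(n,t,1)=0$ if $t\ge 3$; $wg(n,1,1)=n$; $wg(n,2,1)=n-1$ if $n\le 2$ and $wg(n,2,1)=2(n-2)^2+2$ if $n\ge 3$; $wg(n,3,1)=0$ if $n\le 3$ and $wg(n,3,1)=\frac{5n^3-48n^2+157n-174}{6}$ if $n\ge 4$; $wg(n,4,1)=0$ if $n\le 5$ and $wg(n,4,1)=\frac{n^4-16n^3+95n^2-248n+240}{12}$ if $n\ge 6$; $wg(n,t,1)=0$ if $t\ge 5$.
   Context: A simple game on $N=\{1,\dots,n\}$ is a family $\mathcal W$ of subsets of $N$ (winning coalitions) with $\emptyset\notin\mathcal W$, $N\in\mathcal W$, and upward closed. It is weighted if there are reals $w_1,\dots,w_n\ge0$, $q>0$ with $S\in\mathcal W$ iff $\sum_{i\in S}w_i\ge q$. Games are counted up to isomorphism (bijections of players preserving winning coalitions). Desirability: $i\succsim j$ iff for every $S\subseteq N\setminus\{i,j\}$, $S\cup\{j\}\in\mathcal W$ implies $S\cup\{i\}\in\mathcal W$; in a weighted game this is total, and its equivalence classes $N_1,\dots,N_t$ (with $n_h=|N_h|$) are ordered by strictly decreasing desirability. A vector $(m_1,\dots,m_t)$, $0\le m_h\le n_h$, is winning/losing according to whether coalitions with exactly $m_h$ players from each $N_h$ are winning/losing. Write $\tilde a\succeq\tilde b$ iff $\sum_{i\le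 k}a_i\ge\sum_{i\le k}b_i$ for all $k$, and $\tilde a\succ\tilde b$ if also $\tilde a\neq\tilde b$. A shift-minimal winning vector is a winning vector $\tilde m$ such that every $\tilde m'$ with $\tilde m\succ\tilde m'$ is losing. A veto player belongs to every winning coalition; a null player belongs to no minimal winning coalition; a game is non-trivial if it has no veto and no null players. $wg(n,t,r)$ is the number of weighted games with $n$ players, $t$ equivalence classes and $r$ shift-minimal winning vectors, and $\widehat{wg}(n,t,r)$ the number of those which are non-trivial. *)

theory Defs
  imports Complex_Main
begin

definition simple_game :: "'a set \<Rightarrow> 'a set set \<Rightarrow> bool" where
  "simple_game N W \<longleftrightarrow>
     W \<subseteq> Pow N \<and> {} \<notin> W \<and> N \<in> W \<and>
     (\<forall>S T. S \<in> W \<and> S \<subseteq> T \<and> T \<subseteq> N \<longrightarrow> T \<in> W)"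

definition weighted_game :: "'a set \<Rightarrow> 'a set set \<Rightarrow> bool" where
  "weighted_game N W \<longleftrightarrow>
     simple_game N W \<and>
     (\<exists>(w :: 'a \<Rightarrow> real) (q :: real).
        (\<forall>i\<in>N. w i \<ge> 0) \<and> q > 0 \<and>
        (\<forall>S. S \<subseteq> N \<longrightarrow> (S \<in> W \<longleftrightarrow> (\<Sum>i\<in>S. w i) \<ge> q)))"

definition game_iso :: "'a set \<Rightarrow> ('a set set \<times> 'a set set) set" where
  "game_iso N =
     {(W, W'). simple_game N W \<and> simple_game N W' \<and>
        (\<exists>f. bij_betw f N N \<and> (\<forall>S. S \<subseteq> N \<longrightarrow> (S \<in> W \<longleftrightarrow> f ` S \<in> W')))}"

definition desirable :: "'a set \<Rightarrow> 'a set set \<Rightarrow> 'a \<Rightarrow> 'a \<Rightarrow> bool" where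
  "desirable N W i j \<longleftrightarrow>
     (\<forall>S. S \<subseteq> N - {i, j} \<longrightarrow> S \<union> {j} \<in> W \<longrightarrow> S \<union> {i} \<in> W)"

definition desir_equiv :: "'a set \<Rightarrow> 'a set set \<Rightarrow> ('a \<times> 'a) set" where
  "desir_equiv N W =
     {(i, j). i \<in> N \<and> j \<in> N \<and> desirable N W i j \<and> desirable N W j i}"

definition strictly_desirable :: "'a set \<Rightarrow> 'a set set \<Rightarrow> 'a \<Rightarrow> 'a \<Rightarrow> bool" where
  "strictly_desirable N W i j \<longleftrightarrow> desirable N W i j \<and> \<not> desirable N W j i"

text \<open>
  The list $[N_1, \dots, N_t]$ of equivalence classes in strictly decreasing order of
  desirability. It exists and is unique when desirability is total, in particular for
  weighted games on a finite player set; list positions start at 0.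
\<close>

definition class_list :: "'a set \<Rightarrow> 'a set set \<Rightarrow> 'a set list" where
  "class_list N W =
     (THE Ns. set Ns = N // desir_equiv N W \<and>
        sorted_wrt (\<lambda>A B. \<forall>i\<in>A. \<forall>j\<in>B. strictly_desirable N W i j) Ns)"

definition game_vectors :: "'a set \<Rightarrow> 'a set set \<Rightarrow> nat list set" where
  "game_vectors N W =
     {m. length m = length (class_list N W) \<and>
         (\<forall>h<length m. m ! h \<le> card (class_list N W ! h))}"

definition coalitions_of :: "'a set \<Rightarrow> 'a set set \<Rightarrow> nat list \<Rightarrow> 'a set set" where
  "coalitions_of N W m =
     {S. S \<subseteq> N \<and> (\<forall>h<length (class_list N W). card (S \<inter> class_list N W ! h) = m ! h)}"

definition winning_vector :: "'a set \<Rightarrow> 'a set set \<Rightarrow> nat list \<Rightarrow> bool" where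
  "winning_vector N W m \<longleftrightarrow>
     m \<in> game_vectors N W \<and> (\<forall>S\<in>coalitions_of N W m. S \<in> W)"

definition losing_vector :: "'a set \<Rightarrow> 'a set set \<Rightarrow> nat list \<Rightarrow> bool" where
  "losing_vector N W m \<longleftrightarrow>
     m \<in> game_vectors N W \<and> (\<forall>S\<in>coalitions_of N W m. S \<notin> W)"

definition dominates :: "nat list \<Rightarrow> nat list \<Rightarrow> bool" where
  "dominates a b \<longleftrightarrow>
     length a = length b \<and> (\<forall>k\<le>length a. sum_list (take k a) \<ge> sum_list (take k b))"

definition strictly_dominates :: "nat list \<Rightarrow> nat list \<Rightarrow> bool" where
  "strictly_dominates a b \<longleftrightarrow> dominates a b \<and> a \<noteq> b"

definition shift_minimal_winning :: "'a set \<Rightarrow> 'a set set \<Rightarrow> nat list \<Rightarrow> bool" where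
  "shift_minimal_winning N W m \<longleftrightarrow>
     winning_vector N W m \<and>
     (\<forall>m'\<in>game_vectors N W. strictly_dominates m m' \<longrightarrow> losing_vector N W m')"

definition veto_player :: "'a set \<Rightarrow> 'a set set \<Rightarrow> 'a \<Rightarrow> bool" where
  "veto_player N W i \<longleftrightarrow> i \<in> N \<and> (\<forall>S\<in>W. i \<in> S)"

definition minimal_winning :: "'a set set \<Rightarrow> 'a set \<Rightarrow> bool" where
  "minimal_winning W S \<longleftrightarrow> S \<in> W \<and> (\<forall>T. T \<subset> S \<longrightarrow> T \<notin> W)"

definition null_player :: "'a set \<Rightarrow> 'a set set \<Rightarrow> 'a \<Rightarrow> bool" where
  "null_player N W i \<longleftrightarrow> i \<in> N \<and> (\<forall>S. minimal_winning W S \<longrightarrow> i \<notin> S)"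

definition nontrivial_game :: "'a set \<Rightarrow> 'a set set \<Rightarrow> bool" where
  "nontrivial_game N W \<longleftrightarrow> (\<forall>i\<in>N. \<not> veto_player N W i \<and> \<not> null_player N W i)"

definition weighted_games :: "nat \<Rightarrow> nat \<Rightarrow> nat \<Rightarrow> nat set set set" where
  "weighted_games n t r =
     {W. weighted_game {1..n} W \<and>
         card ({1..n} // desir_equiv {1..n} W) = t \<and>
         card {m. shift_minimal_winning {1..n} W m} = r}"

definition wg :: "nat \<Rightarrow> nat \<Rightarrow> nat \<Rightarrow> nat" where
  "wg n t r = card (weighted_games n t r // game_iso {1..n})"

definition wg_hat :: "nat \<Rightarrow> nat \<Rightarrow> nat \<Rightarrow> nat" where
  "wg_hat n t r =
     card ({W \<in> weighted_games n t r. nontrivial_game {1..n} W} // game_iso {1..n})"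

end

theory Submission
  imports Defs
begin

text \<open>
  A weighted game with a unique shift-minimal winning vector \<open>m\<close> consists of the coalitions whose
  class profile dominates \<open>m\<close>, so up to isomorphism it is given by the class sizes \<open>ns\<close> and \<open>m\<close>.
  The classes are the desirability classes exactly if \<open>0 < m\<^sub>h\<close> for every class but the last and
  \<open>m\<^sub>h < ns\<^sub>h\<close> for every class but the first. Only the first class can consist of veto players
  (\<open>m\<^sub>h = ns\<^sub>h\<close>) and only the last of null players (\<open>m\<^sub>h = 0\<close>). Trading players between two
  winning coalitions of profile \<open>m\<close> shows that a weighted game has at most two further classes, and
  that \<open>m\<^sub>h \<in> {1, ns\<^sub>h - 1}\<close> for the second of them; conversely, explicit weights exist in these
  cases. On \<open>k\<close> players this leaves \<open>k - 1\<close> games with one such class and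
  \<open>(k - 2 choose 2) + (k - 3 choose 2)\<close> with two; summing over the numbers of veto and null players
  raises the lower index of the binomial coefficients, since \<open>\<Sum>k<n. (k - s choose r)\<close> is
  \<open>n - s choose (r + 1)\<close>.
\<close>

subsection \<open>Dominance\<close>

lemma sum_list_take_Suc:
  fixes m :: "nat list"
  shows "k < length m \<Longrightarrow> sum_list (take (Suc k) m) = sum_list (take k m) + m ! k"
  by (simp add: take_Suc_conv_app_nth)

lemma dominates_refl: "dominates a a"
  by (simp add: dominates_def)

lemma dominates_trans: "dominates a b \<Longrightarrow> dominates b c \<Longrightarrow> dominates a c"
  unfolding dominates_def by (metis le_trans)

lemma dominates_antisym:
  assumes "dominates a b" "dominates b a"
  shows "a = b"
proof (rule nth_equalityI)
  show same_length: "length a = length b" using assms by (simp add: dominates_def)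
  fix k assume k: "k < length a"
  have same_prefix_sum: "sum_list (take j a) = sum_list (take j b)" if "j \<le> length a" for j
    using assms that same_length by (auto simp: dominates_def intro: le_antisym)
  show "a ! k = b ! k"
    using same_prefix_sum[of k] same_prefix_sum[of "Suc k"] k same_length
    by (simp add: sum_list_take_Suc)
qed

lemma dominates_sum_list: "dominates a b \<Longrightarrow> sum_list b \<le> sum_list a"
  unfolding dominates_def by (metis order_refl take_all)

lemma dominates_snoc:
  "dominates (xs @ [x]) (ys @ [y]) \<longleftrightarrow> dominates xs ys \<and> sum_list ys + y \<le> sum_list xs + x"
  by (auto simp: dominates_def le_Suc_eq)

lemma dominates_Cons:
  "dominates (x # xs) (y # ys) \<longleftrightarrow>
     length xs = length ys \<and> (\<forall>k\<le>length xs. y + sum_list (take k ys) \<le> x + sum_list (take k xs))"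
  by (auto simp: dominates_def take_Cons' split: if_splits)

lemma dominates_Cons_same: "dominates (x # xs) (x # ys) \<longleftrightarrow> dominates xs ys"
  by (auto simp: dominates_Cons) (auto simp: dominates_def)

lemma dominates_Cons_le: "dominates (x # xs) (y # ys) \<Longrightarrow> y \<le> x"
  by (auto simp: dominates_Cons dest: spec[of _ 0])

lemma dominates_snoc_0: "dominates (xs @ [x]) (ys @ [0]) \<longleftrightarrow> dominates xs ys"
  by (auto simp: dominates_snoc dest: dominates_sum_list)

lemma dominates_singleton: "dominates [x] [m] \<longleftrightarrow> m \<le> x"
  using dominates_snoc[of "[]" x "[]" m] by (simp add: dominates_refl)

lemma dominates_pair: "dominates [x, y] [m, k] \<longleftrightarrow> m \<le> x \<and> m + k \<le> x + y"
  using dominates_snoc[of "[x]" y "[m]" k] by (simp add: dominates_singleton)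

lemma wf_strictly_dominates: "wf {(b, a). strictly_dominates a b}"
proof (rule wf_subset)
  let ?potential = "\<lambda>a. \<Sum>k\<le>length a. sum_list (take k a)"
  show "wf (measure ?potential)" by simp
  have "?potential b < ?potential a" if "strictly_dominates a b" for a b
  proof -
    have same_length: "length a = length b"
      and prefix_sum_le: "\<And>k. k \<le> length a \<Longrightarrow> sum_list (take k b) \<le> sum_list (take k a)"
      using that by (auto simp: strictly_dominates_def dominates_def)
    have "\<not> dominates b a" using that dominates_antisym strictly_dominates_def by blast
    then obtain k where "k \<le> length a" "sum_list (take k b) < sum_list (take k a)"
      using same_length by (auto simp: dominates_def not_le)
    then have "(\<Sum>k\<le>length a. sum_list (take k b)) < (\<Sum>k\<le>length a. sum_list (take k a))"
      using prefix_sum_le by (intro sum_strict_mono_ex1) auto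
    then show ?thesis using same_length by simp
  qed
  then show "{(b, a). strictly_dominates a b} \<subseteq> measure ?potential" by auto
qed

subsection \<open>Desirability classes\<close>

lemma desirable_refl: "desirable N W i i"
  by (simp add: desirable_def)

lemma desirable_trans:
  assumes "desirable N W i j" "desirable N W j k" and "i \<in> N" "j \<in> N" "k \<in> N"
  shows "desirable N W i k"
proof (cases "i = j \<or> j = k \<or> i = k")
  case True
  then show ?thesis using assms by (auto simp: desirable_refl)
next
  case False
  show ?thesis
    unfolding desirable_def
  proof (intro allI impI)
    fix T assume T: "T \<subseteq> N - {i, k}" "T \<union> {k} \<in> W"
    show "T \<union> {i} \<in> W"
    proof (cases "j \<in> T")
      case False
      then have "T \<union> {j} \<in> W" using assms(2) T unfolding desirable_def by blast
      moreover have "T \<subseteq> N - {i, j}" using T False by blast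
      ultimately show ?thesis using assms(1) unfolding desirable_def by blast
    next
      case True
      define S where "S = T - {j}"
      have S: "T = S \<union> {j}" "j \<notin> S" using True by (auto simp: S_def)
      have "S \<union> {k} \<subseteq> N - {i, j}" "(S \<union> {k}) \<union> {j} \<in> W"
        using T S assms(5) False by (auto simp: insert_commute)
      then have "(S \<union> {k}) \<union> {i} \<in> W" using assms(1) unfolding desirable_def by blast
      then have "S \<union> {i} \<subseteq> N - {j, k}" "(S \<union> {i}) \<union> {k} \<in> W"
        using T S assms(3) False by (auto simp: insert_commute)
      then have "(S \<union> {i}) \<union> {j} \<in> W" using assms(2) unfolding desirable_def by blast
      then show ?thesis using S by (simp add: insert_commute)
    qed
  qed
qed

lemma strictly_desirable_trans:
  assumes "strictly_desirable N W i j" "strictly_desirable N W j k"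
    and "i \<in> N" "j \<in> N" "k \<in> N"
  shows "strictly_desirable N W i k"
  using assms desirable_trans[of N W i j k] desirable_trans[of N W k i j]
  by (auto simp: strictly_desirable_def)

lemma equiv_desir_equiv: "equiv N (desir_equiv N W)"
proof (rule equivI)
  show "desir_equiv N W \<subseteq> N \<times> N" by (auto simp: desir_equiv_def)
  show "refl_on N (desir_equiv N W)"
    by (auto simp: refl_on_def desir_equiv_def desirable_refl)
  show "sym (desir_equiv N W)" by (auto simp: sym_def desir_equiv_def)
  show "trans (desir_equiv N W)"
  proof (rule transI)
    fix i j k assume "(i, j) \<in> desir_equiv N W" "(j, k) \<in> desir_equiv N W"
    then show "(i, k) \<in> desir_equiv N W"
      using desirable_trans[of N W i j k] desirable_trans[of N W k j i]
      by (simp add: desir_equiv_def)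
  qed
qed

lemma desir_class_subset: "A \<in> N // desir_equiv N W \<Longrightarrow> A \<subseteq> N"
  by (rule in_quotient_imp_subset[OF equiv_desir_equiv])

lemma desir_class_nonempty: "A \<in> N // desir_equiv N W \<Longrightarrow> A \<noteq> {}"
  by (rule in_quotient_imp_non_empty[OF equiv_desir_equiv])

definition class_above :: "'a set \<Rightarrow> 'a set set \<Rightarrow> 'a set \<Rightarrow> 'a set \<Rightarrow> bool" where
  "class_above N W A B \<longleftrightarrow> (\<forall>i\<in>A. \<forall>j\<in>B. strictly_desirable N W i j)"

definition class_chain :: "'a set \<Rightarrow> 'a set set \<Rightarrow> 'a set list \<Rightarrow> bool" where
  "class_chain N W Ns \<longleftrightarrow> set Ns = N // desir_equiv N W \<and> sorted_wrt (class_above N W) Ns"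

lemma class_above_if_desirable:
  assumes A: "A \<in> N // desir_equiv N W" and B: "B \<in> N // desir_equiv N W" and "A \<noteq> B"
    and ij: "i \<in> A" "j \<in> B" "desirable N W i j"
  shows "class_above N W A B"
  unfolding class_above_def
proof (intro ballI)
  fix i' j' assume ij': "i' \<in> A" "j' \<in> B"
  have N: "i \<in> N" "j \<in> N" "i' \<in> N" "j' \<in> N"
    using ij ij' A B desir_class_subset by blast+
  have "desirable N W i' i" "desirable N W j j'"
    using quotient_eq_iff[OF equiv_desir_equiv A A ij'(1) ij(1)]
      quotient_eq_iff[OF equiv_desir_equiv B B ij(2) ij'(2)] by (simp_all add: desir_equiv_def)
  then have "desirable N W i' j'" using ij(3) N desirable_trans by metis
  moreover have "(i', j') \<notin> desir_equiv N W"
    using quotient_eq_iff[OF equiv_desir_equiv A B ij'] \<open>A \<noteq> B\<close> by blast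
  ultimately show "strictly_desirable N W i' j'"
    using N by (auto simp: strictly_desirable_def desir_equiv_def)
qed

lemma ex_sorted_wrt:
  assumes "finite A" "transp_on A R" "totalp_on A R"
  shows "\<exists>xs. set xs = A \<and> sorted_wrt R xs"
  using assms
proof (induction A rule: finite_induct)
  case (insert x A)
  then obtain xs where xs: "set xs = A" "sorted_wrt R xs"
    by (meson subset_insertI totalp_on_subset transp_on_subset)
  define ys where "ys = filter (\<lambda>y. R y x) xs @ x # filter (\<lambda>y. \<not> R y x) xs"
  have above: "R x y" if "y \<in> A" "\<not> R y x" for y
    using that insert.hyps(2) totalp_onD[OF insert.prems(2), of x y] by auto
  moreover have "R y z" if "y \<in> A" "z \<in> A" "R y x" "\<not> R z x" for y z
    using that above[of z] transp_onD[OF insert.prems(1), of y x z] by simp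
  ultimately have "sorted_wrt R ys"
    using xs by (auto simp: ys_def sorted_wrt_append sorted_wrt_filter)
  moreover have "set ys = insert x A" using xs by (auto simp: ys_def)
  ultimately show ?case by blast
qed simp

lemma sorted_wrt_unique:
  assumes "sorted_wrt R xs" "sorted_wrt R ys" "set xs = set ys" "asymp_on (set xs) R"
  shows "xs = ys"
  using assms
proof (induction xs arbitrary: ys)
  case (Cons x xs)
  obtain y ys' where ys: "ys = y # ys'" using Cons.prems(3) by (cases ys) auto
  have heads: "\<forall>z\<in>set xs. R x z" "\<forall>z\<in>set ys'. R y z"
    using Cons.prems(1,2) ys by simp_all
  have asymmetric: "\<not> R b a" if "R a b" "a \<in> set (x # xs)" "b \<in> set (x # xs)" for a b
    using asymp_onD[OF Cons.prems(4)] that by blast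
  have "x = y"
  proof (rule ccontr)
    assume "x \<noteq> y"
    then have "y \<in> set xs" "x \<in> set ys'" using Cons.prems(3) ys by (auto simp: set_eq_iff)
    then show False using heads asymmetric[of x y] by simp
  qed
  moreover have "x \<notin> set xs" "y \<notin> set ys'"
    using heads asymmetric[of x x] asymmetric[of y y] \<open>x = y\<close> by auto
  ultimately have "set xs = set ys'" using Cons.prems(3) ys by (simp add: insert_eq_iff)
  moreover have "asymp_on (set xs) R"
    using Cons.prems(4) by (rule asymp_on_subset) auto
  ultimately show ?case using Cons ys \<open>x = y\<close> by simp
qed simp

lemma ex_class_chain:
  assumes "finite N"
    and total: "\<And>i j. i \<in> N \<Longrightarrow> j \<in> N \<Longrightarrow> desirable N W i j \<or> desirable N W j i"
  shows "\<exists>Ns. class_chain N W Ns"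
proof -
  let ?C = "N // desir_equiv N W"
  have "finite ?C"
    using assms(1) by (intro finite_quotient) (auto simp: desir_equiv_def)
  moreover have "transp_on ?C (class_above N W)"
  proof (rule transp_onI)
    fix A B C assume classes: "A \<in> ?C" "B \<in> ?C" "C \<in> ?C"
      and above: "class_above N W A B" "class_above N W B C"
    obtain j where "j \<in> B" using desir_class_nonempty classes(2) by blast
    with above show "class_above N W A C"
      unfolding class_above_def
      using classes desir_class_subset strictly_desirable_trans by (metis in_mono)
  qed
  moreover have "totalp_on ?C (class_above N W)"
  proof (rule totalp_onI)
    fix A B assume AB: "A \<in> ?C" "B \<in> ?C" "A \<noteq> B"
    obtain i j where ij: "i \<in> A" "j \<in> B" using AB desir_class_nonempty by blast
    then have "desirable N W i j \<or> desirable N W j i" using total AB desir_class_subset by blast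
    then show "class_above N W A B \<or> class_above N W B A"
      using class_above_if_desirable AB ij by metis
  qed
  ultimately show ?thesis unfolding class_chain_def by (rule ex_sorted_wrt)
qed

lemma class_chain_unique:
  assumes "class_chain N W Ns" "class_chain N W Ns'"
  shows "Ns = Ns'"
proof (rule sorted_wrt_unique)
  show "sorted_wrt (class_above N W) Ns" "sorted_wrt (class_above N W) Ns'" "set Ns = set Ns'"
    using assms by (auto simp: class_chain_def)
  show "asymp_on (set Ns) (class_above N W)"
  proof (rule asymp_onI)
    fix A B assume "A \<in> set Ns" "B \<in> set Ns" and above: "class_above N W A B"
    then have "A \<noteq> {}" "B \<noteq> {}"
      using assms(1) desir_class_nonempty by (metis class_chain_def)+
    with above show "\<not> class_above N W B A"
      unfolding class_above_def strictly_desirable_def by blast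
  qed
qed

lemma class_list_eq:
  assumes "class_chain N W Ns"
  shows "class_list N W = Ns"
proof -
  have "class_list N W = (THE Ns. class_chain N W Ns)"
    by (simp add: class_list_def class_chain_def class_above_def[abs_def])
  with assms show ?thesis by (auto intro: class_chain_unique)
qed

lemma class_chain_strict:
  assumes "class_chain N W Ns" "a < b" "b < length Ns" "i \<in> Ns ! a" "j \<in> Ns ! b"
  shows "strictly_desirable N W i j"
  using assms by (auto simp: class_chain_def sorted_wrt_iff_nth_less class_above_def)

lemma class_chain_desirable:
  assumes "class_chain N W Ns" "a \<le> b" "b < length Ns" "i \<in> Ns ! a" "j \<in> Ns ! b"
  shows "desirable N W i j"
proof (cases "a = b")
  case True
  then have "Ns ! a \<in> N // desir_equiv N W" using assms by (metis class_chain_def nth_mem)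
  then have "(i, j) \<in> desir_equiv N W"
    using quotient_eq_iff[OF equiv_desir_equiv] assms True by fastforce
  then show ?thesis by (simp add: desir_equiv_def)
next
  case False
  then have "strictly_desirable N W i j" using assms by (intro class_chain_strict) auto
  then show ?thesis by (simp add: strictly_desirable_def)
qed

lemma weighted_game_desirable_total:
  assumes "weighted_game N W" "finite N" "i \<in> N" "j \<in> N"
  shows "desirable N W i j \<or> desirable N W j i"
proof -
  obtain w :: "'a \<Rightarrow> real" and q where W: "\<And>S. S \<subseteq> N \<Longrightarrow> S \<in> W \<longleftrightarrow> q \<le> sum w S"
    using assms(1) unfolding weighted_game_def by blast
  have "desirable N W i j" if "w j \<le> w i" "i \<in> N" "j \<in> N" for i j
    unfolding desirable_def
  proof (intro allI impI)
    fix S assume S: "S \<subseteq> N - {i, j}" "S \<union> {j} \<in> W"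
    then have "finite S" "i \<notin> S" "j \<notin> S" using assms(2) finite_subset by blast+
    then have "sum w (S \<union> {j}) \<le> sum w (S \<union> {i})" using that by simp
    moreover have "S \<union> {j} \<subseteq> N" "S \<union> {i} \<subseteq> N" using S that by auto
    ultimately show "S \<union> {i} \<in> W" using S W by force
  qed
  then show ?thesis using assms(3,4) linear[of "w i" "w j"] by blast
qed

subsection \<open>Ordered partitions\<close>

definition upper :: "'a set list \<Rightarrow> nat \<Rightarrow> 'a set" where
  "upper Ns k = \<Union> (set (take k Ns))"

definition profile :: "'a set list \<Rightarrow> 'a set \<Rightarrow> nat list" where
  "profile Ns S = map (\<lambda>A. card (S \<inter> A)) Ns"

lemma length_profile [simp]: "length (profile Ns S) = length Ns"
  by (simp add: profile_def)

lemma nth_profile [simp]: "h < length Ns \<Longrightarrow> profile Ns S ! h = card (S \<inter> Ns ! h)"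
  by (simp add: profile_def)

locale ordered_partition =
  fixes N :: "'a set" and Ns :: "'a set list"
  assumes finite_players: "finite N"
    and Union_blocks: "\<Union> (set Ns) = N"
    and block_nonempty: "A \<in> set Ns \<Longrightarrow> A \<noteq> {}"
    and block_disjoint: "a < length Ns \<Longrightarrow> b < length Ns \<Longrightarrow> a \<noteq> b \<Longrightarrow> Ns ! a \<inter> Ns ! b = {}"
begin

lemma block_subset: "a < length Ns \<Longrightarrow> Ns ! a \<subseteq> N"
  using Union_blocks by auto

lemma finite_block: "a < length Ns \<Longrightarrow> finite (Ns ! a)"
  using block_subset finite_players finite_subset by blast

lemma block_mem: "i \<in> N \<Longrightarrow> \<exists>a<length Ns. i \<in> Ns ! a"
  using Union_blocks by (metis UnionE in_set_conv_nth)

lemma block_unique: "a < length Ns \<Longrightarrow> b < length Ns \<Longrightarrow> i \<in> Ns ! a \<Longrightarrow> i \<in> Ns ! b \<Longrightarrow> a = b"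
  using block_disjoint by blast

lemma block_mem_iff: "a < length Ns \<Longrightarrow> i \<in> Ns ! a \<Longrightarrow> h < length Ns \<Longrightarrow> i \<in> Ns ! h \<longleftrightarrow> h = a"
  using block_unique by blast

lemma card_block_pos: "a < length Ns \<Longrightarrow> 0 < card (Ns ! a)"
  using block_nonempty finite_block by (simp add: card_gt_0_iff)

lemma distinct_blocks: "distinct Ns"
  unfolding distinct_conv_nth using block_disjoint block_nonempty by (metis Int_absorb nth_mem)

lemma upper_0 [simp]: "upper Ns 0 = {}"
  by (simp add: upper_def)

lemma upper_length [simp]: "upper Ns (length Ns) = N"
  using Union_blocks by (simp add: upper_def)

lemma upper_Suc: "k < length Ns \<Longrightarrow> upper Ns (Suc k) = upper Ns k \<union> Ns ! k"
  by (auto simp: upper_def take_Suc_conv_app_nth)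

lemma finite_inter_upper: "finite (S \<inter> upper Ns k)"
proof -
  have "upper Ns k \<subseteq> N" using Union_blocks set_take_subset[of k Ns] by (auto simp: upper_def)
  then show ?thesis using finite_players by (meson finite_Int finite_subset)
qed

lemma mem_upper:
  assumes "a < length Ns" "i \<in> Ns ! a" "k \<le> length Ns"
  shows "i \<in> upper Ns k \<longleftrightarrow> a < k"
proof
  assume "i \<in> upper Ns k"
  then obtain b where "b < k" "b < length Ns" "i \<in> Ns ! b"
    by (auto simp: upper_def in_set_conv_nth)
  then show "a < k" using block_unique assms by blast
next
  assume "a < k"
  then have "Ns ! a \<in> set (take k Ns)"
    using assms by (metis length_take min.absorb2 nth_mem nth_take)
  then show "i \<in> upper Ns k" using assms by (auto simp: upper_def)
qed

lemma card_insert_inter_upper: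
  assumes "a < length Ns" "i \<in> Ns ! a" "i \<notin> S" "k \<le> length Ns"
  shows "card (insert i S \<inter> upper Ns k) = card (S \<inter> upper Ns k) + of_bool (a < k)"
  using assms mem_upper finite_inter_upper by (simp add: Int_insert_left)

lemma card_inter_upper_Suc:
  assumes "k < length Ns"
  shows "card (S \<inter> upper Ns (Suc k)) = card (S \<inter> upper Ns k) + card (S \<inter> Ns ! k)"
proof -
  have "upper Ns k \<inter> Ns ! k = {}" using mem_upper[OF assms] assms by fastforce
  then show ?thesis
    unfolding upper_Suc[OF assms] Int_Un_distrib
    using finite_inter_upper finite_block[OF assms] by (intro card_Un_disjoint) auto
qed

lemma sum_take_profile:
  "k \<le> length Ns \<Longrightarrow> sum_list (take k (profile Ns S)) = card (S \<inter> upper Ns k)"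
proof (induction k)
  case (Suc k)
  then show ?case by (simp add: sum_list_take_Suc card_inter_upper_Suc)
qed simp

lemma sum_list_card_blocks: "sum_list (map card Ns) = card N"
proof -
  have "profile Ns N = map card Ns"
    using block_subset by (intro nth_equalityI) (auto simp: Int_absorb1)
  then show ?thesis using sum_take_profile[of "length Ns" N] by simp
qed

lemma dominates_profile:
  "dominates (profile Ns S) m \<longleftrightarrow>
     length m = length Ns \<and> (\<forall>k\<le>length Ns. sum_list (take k m) \<le> card (S \<inter> upper Ns k))"
  by (auto simp: dominates_def sum_take_profile)

lemma dominates_profile_profile:
  "dominates (profile Ns S) (profile Ns T) \<longleftrightarrow>
     (\<forall>k\<le>length Ns. card (T \<inter> upper Ns k) \<le> card (S \<inter> upper Ns k))"
  by (simp add: dominates_profile sum_take_profile)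

lemma dominates_profile_mono: "T \<subseteq> S \<Longrightarrow> dominates (profile Ns S) (profile Ns T)"
  unfolding dominates_profile_profile using finite_inter_upper by (auto intro: card_mono)

lemma dominates_profile_card_le:
  assumes "S \<subseteq> N" "T \<subseteq> N" "dominates (profile Ns S) (profile Ns T)"
  shows "card T \<le> card S"
proof -
  have "card (T \<inter> upper Ns (length Ns)) \<le> card (S \<inter> upper Ns (length Ns))"
    using assms(3) unfolding dominates_profile_profile by blast
  then show ?thesis using assms(1,2) by (simp add: Int_absorb2)
qed

lemma not_dominates_profile_if_psubset:
  assumes "k \<le> length Ns" "S \<inter> upper Ns k \<subset> T \<inter> upper Ns k"
  shows "\<not> dominates (profile Ns S) (profile Ns T)"
proof -
  have "card (S \<inter> upper Ns k) < card (T \<inter> upper Ns k)"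
    using finite_inter_upper assms(2) by (rule psubset_card_mono)
  then show ?thesis using assms(1) by (auto simp: dominates_profile_profile not_le)
qed

lemma profile_le_card_blocks: "list_all2 (\<le>) (profile Ns S) (map card Ns)"
  using finite_block by (auto simp: list_all2_conv_all_nth intro: card_mono)

lemma profile_insert_cong:
  assumes "a < length Ns" "i \<in> Ns ! a" "j \<in> Ns ! a" "i \<notin> S" "j \<notin> T"
    and "profile Ns S = profile Ns T"
  shows "profile Ns (insert i S) = profile Ns (insert j T)"
proof (rule nth_equalityI)
  fix h assume "h < length (profile Ns (insert i S))"
  then have h: "h < length Ns" by simp
  then have "card (S \<inter> Ns ! h) = card (T \<inter> Ns ! h)" using assms(6) by (metis nth_profile)
  then show "profile Ns (insert i S) ! h = profile Ns (insert j T) ! h"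
    using h assms(4,5) block_mem_iff[OF assms(1,2) h] block_mem_iff[OF assms(1,3) h]
      finite_block[OF h] by (auto simp: Int_insert_left)
qed simp

lemma profile_Un_cong:
  assumes "A \<inter> B = {}" "A \<inter> C = {}" "profile Ns B = profile Ns C"
  shows "profile Ns (A \<union> B) = profile Ns (A \<union> C)"
proof (rule nth_equalityI)
  fix h assume "h < length (profile Ns (A \<union> B))"
  then have h: "h < length Ns" by simp
  have "card ((A \<union> X) \<inter> Ns ! h) = card (A \<inter> Ns ! h) + card (X \<inter> Ns ! h)" if "A \<inter> X = {}" for X
    unfolding Int_Un_distrib2 using that finite_block[OF h] by (intro card_Un_disjoint) auto
  moreover have "card (B \<inter> Ns ! h) = card (C \<inter> Ns ! h)"
    using assms(3) h by (metis nth_profile)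
  ultimately show "profile Ns (A \<union> B) ! h = profile Ns (A \<union> C) ! h" using assms(1,2) h by simp
qed simp

lemma profile_exchange:
  assumes "a < length Ns" "i \<in> Ns ! a" "j \<in> Ns ! a" "i \<in> T - P" "j \<notin> T \<union> Q"
    and "P \<subseteq> T" "Q \<inter> T = {}" "profile Ns P = profile Ns Q"
  shows "profile Ns ((T - insert i P) \<union> insert j Q) = profile Ns T"
proof -
  have "profile Ns (insert j Q) = profile Ns (insert i P)"
    using assms by (intro profile_insert_cong) auto
  then have "profile Ns ((T - insert i P) \<union> insert j Q) =
      profile Ns ((T - insert i P) \<union> insert i P)"
    using assms by (intro profile_Un_cong) auto
  also have "(T - insert i P) \<union> insert i P = T" using assms by auto
  finally show ?thesis .
qed

lemma UN_inter_block:
  assumes "\<And>h. h < length Ns \<Longrightarrow> B h \<subseteq> Ns ! h" "h < length Ns"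
  shows "(\<Union>h<length Ns. B h) \<inter> Ns ! h = B h"
  using assms block_unique by fastforce

lemma coalition_with_profile:
  assumes "length m = length Ns" "I \<subseteq> N" "I \<inter> J = {}"
    and bounds: "\<And>h. h < length Ns \<Longrightarrow>
      card (I \<inter> Ns ! h) \<le> m ! h \<and> m ! h \<le> card (Ns ! h - J)"
  shows "\<exists>T\<subseteq>N. I \<subseteq> T \<and> T \<inter> J = {} \<and> profile Ns T = m"
proof -
  have "\<exists>B. I \<inter> Ns ! h \<subseteq> B \<and> B \<subseteq> Ns ! h - J \<and> card B = m ! h" if "h < length Ns" for h
    using exists_subset_between[of "I \<inter> Ns ! h" "m ! h" "Ns ! h - J"] bounds[OF that]
      assms(3) finite_block[OF that] by blast
  then obtain B where B: "\<And>h. h < length Ns \<Longrightarrow>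
      I \<inter> Ns ! h \<subseteq> B h \<and> B h \<subseteq> Ns ! h - J \<and> card (B h) = m ! h"
    by metis
  let ?T = "\<Union>h<length Ns. B h"
  have "?T \<subseteq> N" "?T \<inter> J = {}" using B block_subset by blast+
  moreover have "I \<subseteq> ?T"
  proof
    fix i assume i: "i \<in> I"
    then obtain h where h: "h < length Ns" "i \<in> Ns ! h" using block_mem assms(2) by blast
    then show "i \<in> ?T" using B[OF h(1)] i by blast
  qed
  moreover have "?T \<inter> Ns ! h = B h" if "h < length Ns" for h
    using B that by (intro UN_inter_block) blast
  then have "profile Ns ?T = m"
    using B assms(1) by (intro nth_equalityI) simp_all
  ultimately show ?thesis by blast
qed

lemma ex_coalition_with_profile:
  assumes "list_all2 (\<le>) m (map card Ns)"
  shows "\<exists>T\<subseteq>N. profile Ns T = m"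
  using coalition_with_profile[of m "{}" "{}"] assms by (auto simp: list_all2_conv_all_nth)

text \<open>
  Take for \<open>j\<close> a highest ranked member of \<open>T - S\<close>: above its block \<open>T\<close> is contained in \<open>S\<close>, so the
  counts force a member \<open>i\<close> of \<open>S - T\<close> that is ranked at least as high.
\<close>

lemma dominates_exchange:
  assumes "S \<subseteq> N" and dom: "dominates (profile Ns S) (profile Ns T)" and "T \<subseteq> N" "\<not> T \<subseteq> S"
  obtains a b i j where "a \<le> b" "b < length Ns" "i \<in> Ns ! a" "j \<in> Ns ! b" "i \<in> S - T" "j \<in> T - S"
    "dominates (profile Ns S) (profile Ns (insert i (T - {j})))"
proof -
  have "\<not> T \<inter> upper Ns (length Ns) \<subseteq> S" "T \<inter> upper Ns 0 \<subseteq> S"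
    using \<open>T \<subseteq> N\<close> \<open>\<not> T \<subseteq> S\<close> by auto
  then obtain b where b: "b < length Ns" "\<not> T \<inter> upper Ns (Suc b) \<subseteq> S"
    and above: "\<And>l. l \<le> b \<Longrightarrow> T \<inter> upper Ns l \<subseteq> S"
    using ex_least_nat_less[of "\<lambda>l. \<not> T \<inter> upper Ns l \<subseteq> S" "length Ns"] by blast
  then obtain j where j: "j \<in> T - S" "j \<in> Ns ! b" using above[of b] by (auto simp: upper_Suc)
  have "\<exists>i\<in>S - T. i \<in> upper Ns (Suc b)"
  proof (rule ccontr)
    assume "\<not> ?thesis"
    then have "S \<inter> upper Ns (Suc b) \<subset> T \<inter> upper Ns (Suc b)" using b(2) by blast
    then show False using not_dominates_profile_if_psubset[of "Suc b"] b(1) dom by simp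
  qed
  then obtain i where i: "i \<in> S - T" "i \<in> upper Ns (Suc b)" by blast
  then obtain a where a: "a < length Ns" "i \<in> Ns ! a" using \<open>S \<subseteq> N\<close> block_mem by blast
  then have "a \<le> b" using i b(1) mem_upper[of a i "Suc b"] by simp
  have "card (insert i (T - {j}) \<inter> upper Ns l) \<le> card (S \<inter> upper Ns l)" if l: "l \<le> length Ns" for l
  proof (cases "l \<le> b")
    case True
    then have "insert i (T - {j}) \<inter> upper Ns l \<subseteq> S \<inter> upper Ns l" using above[OF True] i by auto
    then show ?thesis by (intro card_mono finite_inter_upper)
  next
    case False
    have "card (insert i (T - {j}) \<inter> upper Ns l) = card (insert j (T - {j}) \<inter> upper Ns l)"
      using card_insert_inter_upper[OF a, of "T - {j}" l]
        card_insert_inter_upper[OF b(1) j(2), of "T - {j}" l] i l False \<open>a \<le> b\<close> by simp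
    then show ?thesis using dom l j(1) by (simp add: dominates_profile_profile insert_absorb)
  qed
  then have "dominates (profile Ns S) (profile Ns (insert i (T - {j})))"
    by (simp add: dominates_profile_profile)
  with that \<open>a \<le> b\<close> b(1) a(2) j(2) i(1) j(1) show thesis by blast
qed

end

lemma class_chain_partition:
  assumes "class_chain N W Ns" "finite N"
  shows "ordered_partition N Ns"
proof
  have classes: "set Ns = N // desir_equiv N W" using assms by (simp add: class_chain_def)
  show "finite N" by fact
  show "\<Union> (set Ns) = N" using Union_quotient[OF equiv_desir_equiv] classes by metis
  show "A \<noteq> {}" if "A \<in> set Ns" for A using desir_class_nonempty that classes by metis
  have "Ns ! a \<inter> Ns ! b = {}" if ab: "a < b" "b < length Ns" for a b
    using class_chain_strict[OF assms(1) ab] unfolding strictly_desirable_def by blast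
  then show "Ns ! a \<inter> Ns ! b = {}" if "a < length Ns" "b < length Ns" "a \<noteq> b" for a b
    using that by (metis Int_commute nat_neq_iff)
qed

subsection \<open>Shift-minimal vectors\<close>

definition vector_game :: "'a set \<Rightarrow> 'a set list \<Rightarrow> nat list \<Rightarrow> 'a set set" where
  "vector_game N Ns m = {S. S \<subseteq> N \<and> dominates (profile Ns S) m}"

locale ranked_game =
  fixes N :: "'a set" and W :: "'a set set" and Ns :: "'a set list"
  assumes finite_N: "finite N" and simple: "simple_game N W" and chain: "class_chain N W Ns"

sublocale ranked_game \<subseteq> ordered_partition N Ns
  by (rule class_chain_partition[OF chain finite_N])

context ranked_game
begin

lemma winning_subset: "S \<in> W \<Longrightarrow> S \<subseteq> N"
  using simple by (auto simp: simple_game_def)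

lemma card_desir_classes: "card (N // desir_equiv N W) = length Ns"
  using chain distinct_card[OF distinct_blocks] by (simp add: class_chain_def)

lemma game_vectors_eq: "game_vectors N W = {m. list_all2 (\<le>) m (map card Ns)}"
  by (auto simp: game_vectors_def class_list_eq[OF chain] list_all2_conv_all_nth)

lemma coalitions_of_eq:
  "length m = length Ns \<Longrightarrow> coalitions_of N W m = {S. S \<subseteq> N \<and> profile Ns S = m}"
  by (auto simp: coalitions_of_def class_list_eq[OF chain] list_eq_iff_nth_eq)

lemma winning_if_dominates:
  assumes "T \<in> W" "S \<subseteq> N" "dominates (profile Ns S) (profile Ns T)"
  shows "S \<in> W"
  using assms(1,3)
proof (induction "card (T - S)" arbitrary: T rule: less_induct)
  case less
  have "T \<subseteq> N" using less.prems(1) by (rule winning_subset)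
  show ?case
  proof (cases "T \<subseteq> S")
    case True
    then show ?thesis using less.prems(1) simple \<open>S \<subseteq> N\<close> unfolding simple_game_def by blast
  next
    case False
    obtain a b i j where ab: "a \<le> b" "b < length Ns" "i \<in> Ns ! a" "j \<in> Ns ! b"
      and i: "i \<in> S - T" and j: "j \<in> T - S"
      and dom: "dominates (profile Ns S) (profile Ns (insert i (T - {j})))"
      using dominates_exchange[OF \<open>S \<subseteq> N\<close> less.prems(2) \<open>T \<subseteq> N\<close> False] .
    have "desirable N W i j" by (rule class_chain_desirable[OF chain ab])
    moreover have "T - {j} \<subseteq> N - {i, j}" "(T - {j}) \<union> {j} \<in> W"
      using \<open>T \<subseteq> N\<close> i j less.prems(1) by (auto simp: insert_absorb)
    ultimately have "insert i (T - {j}) \<in> W" unfolding desirable_def by auto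
    moreover have "insert i (T - {j}) - S \<subset> T - S" using i j by auto
    then have "card (insert i (T - {j}) - S) < card (T - S)"
      using \<open>T \<subseteq> N\<close> finite_N by (meson finite_Diff finite_subset psubset_card_mono)
    ultimately show ?thesis using less.hyps dom by blast
  qed
qed

lemma winning_losing_profile:
  assumes "T \<subseteq> N"
  shows "winning_vector N W (profile Ns T) \<longleftrightarrow> T \<in> W"
    and "losing_vector N W (profile Ns T) \<longleftrightarrow> T \<notin> W"
proof -
  have "profile Ns T \<in> game_vectors N W"
    using profile_le_card_blocks by (simp add: game_vectors_eq)
  moreover have "S \<in> W \<longleftrightarrow> T \<in> W" if "S \<subseteq> N" "profile Ns S = profile Ns T" for S
    using winning_if_dominates[of S T] winning_if_dominates[of T S] that assms
    by (auto simp: dominates_refl)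
  ultimately show "winning_vector N W (profile Ns T) \<longleftrightarrow> T \<in> W"
    "losing_vector N W (profile Ns T) \<longleftrightarrow> T \<notin> W"
    unfolding winning_vector_def losing_vector_def coalitions_of_eq[OF length_profile]
    using assms by blast+
qed

lemma ex_shift_minimal_winning:
  assumes "S \<in> W"
  shows "\<exists>m. shift_minimal_winning N W m \<and> dominates (profile Ns S) m"
proof -
  let ?Q = "{x. winning_vector N W x \<and> dominates (profile Ns S) x}"
  have "profile Ns S \<in> ?Q"
    using winning_losing_profile(1)[OF winning_subset] assms by (simp add: dominates_refl)
  then obtain x where x: "x \<in> ?Q"
    and min: "\<And>y. (y, x) \<in> {(b, a). strictly_dominates a b} \<Longrightarrow> y \<notin> ?Q"
    using wfE_min[OF wf_strictly_dominates] by metis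
  have "losing_vector N W y" if y: "y \<in> game_vectors N W" "strictly_dominates x y" for y
  proof -
    obtain T where T: "T \<subseteq> N" "profile Ns T = y"
      using ex_coalition_with_profile y(1) by (auto simp: game_vectors_eq)
    have "dominates (profile Ns S) y"
      using x y(2) dominates_trans by (auto simp: strictly_dominates_def)
    then have "\<not> winning_vector N W y" using min[of y] y(2) by blast
    then show ?thesis using winning_losing_profile[OF T(1)] T(2) by simp
  qed
  then have "shift_minimal_winning N W x" using x by (simp add: shift_minimal_winning_def)
  then show ?thesis using x by blast
qed

lemma winning_eq_UN_vector_game:
  "W = (\<Union>m\<in>{m. shift_minimal_winning N W m}. vector_game N Ns m)"
proof (intro equalityI subsetI)
  fix S assume "S \<in> W"
  then show "S \<in> (\<Union>m\<in>{m. shift_minimal_winning N W m}. vector_game N Ns m)"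
    using ex_shift_minimal_winning winning_subset by (auto simp: vector_game_def)
next
  fix S assume "S \<in> (\<Union>m\<in>{m. shift_minimal_winning N W m}. vector_game N Ns m)"
  then obtain m where m: "winning_vector N W m" and S: "S \<subseteq> N" "dominates (profile Ns S) m"
    by (auto simp: vector_game_def shift_minimal_winning_def)
  then have "list_all2 (\<le>) m (map card Ns)" by (simp add: winning_vector_def game_vectors_eq)
  then obtain T where T: "T \<subseteq> N" "profile Ns T = m" using ex_coalition_with_profile by blast
  then show "S \<in> W"
    using winning_if_dominates S winning_losing_profile(1)[OF T(1)] m by blast
qed

lemma unique_shift_minimal_iff:
  "{m'. shift_minimal_winning N W m'} = {m} \<longleftrightarrow>
     list_all2 (\<le>) m (map card Ns) \<and> W = vector_game N Ns m"
proof
  assume unique: "{m'. shift_minimal_winning N W m'} = {m}"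
  then have "m \<in> game_vectors N W"
    by (auto simp: set_eq_iff shift_minimal_winning_def winning_vector_def)
  then show "list_all2 (\<le>) m (map card Ns) \<and> W = vector_game N Ns m"
    using winning_eq_UN_vector_game unique by (simp add: game_vectors_eq)
next
  assume m: "list_all2 (\<le>) m (map card Ns) \<and> W = vector_game N Ns m"
  have gv: "m \<in> game_vectors N W" using m unfolding game_vectors_eq by blast
  have realised: "\<exists>T\<subseteq>N. profile Ns T = x" if "x \<in> game_vectors N W" for x
    using that ex_coalition_with_profile by (simp add: game_vectors_eq)
  have mem: "T \<in> W \<longleftrightarrow> dominates (profile Ns T) m" if "T \<subseteq> N" for T
    using m that by (simp add: vector_game_def)
  have "winning_vector N W x \<longleftrightarrow> x \<in> game_vectors N W \<and> dominates x m" for x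
    using realised[of x] winning_losing_profile(1) mem by (metis winning_vector_def)
  moreover have "losing_vector N W x \<longleftrightarrow> x \<in> game_vectors N W \<and> \<not> dominates x m" for x
    using realised[of x] winning_losing_profile(2) mem by (metis losing_vector_def)
  ultimately show "{m'. shift_minimal_winning N W m'} = {m}"
    using gv by (auto simp: shift_minimal_winning_def strictly_dominates_def dominates_refl
        dest: dominates_antisym)
qed

end

subsection \<open>Vector games\<close>

definition admissible :: "nat list \<Rightarrow> nat list \<Rightarrow> bool" where
  "admissible ns m \<longleftrightarrow> ns \<noteq> [] \<and> list_all2 (\<le>) m ns \<and> (\<forall>a\<in>set ns. 0 < a) \<and> 0 < m ! 0 \<and>
     (\<forall>h. Suc h < length ns \<longrightarrow> 0 < m ! h \<and> m ! Suc h < ns ! Suc h)"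

context ranked_game
begin

lemma consecutive_class_bounds:
  assumes W: "W = vector_game N Ns m" and length_m: "length m = length Ns"
    and h: "Suc h < length Ns"
  shows "0 < m ! h \<and> m ! Suc h < card (Ns ! Suc h)"
proof -
  have h_less: "h < length Ns" using h by simp
  obtain i j where i: "i \<in> Ns ! h" and j: "j \<in> Ns ! Suc h"
    using block_nonempty h_less h by (metis all_not_in_conv nth_mem)
  have "\<not> desirable N W j i"
    using class_chain_strict[OF chain lessI h i j] by (simp add: strictly_desirable_def)
  then obtain S where S: "S \<subseteq> N - {j, i}"
    and insert_i: "insert i S \<in> W" and insert_j: "insert j S \<notin> W"
    by (auto simp: desirable_def)
  let ?M = "\<lambda>k. sum_list (take k m)"
  have win: "?M k \<le> card (S \<inter> upper Ns k) + of_bool (h < k)" if "k \<le> length Ns" for k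
    using insert_i card_insert_inter_upper[OF h_less i _ that, of S] S that
    unfolding W vector_game_def dominates_profile by fastforce
  have "insert j S \<subseteq> N" using S j block_subset[OF h] by auto
  then obtain k where k: "k \<le> length Ns" "card (insert j S \<inter> upper Ns k) < ?M k"
    using insert_j length_m unfolding W vector_game_def dominates_profile by fastforce
  have card_j: "card (insert j S \<inter> upper Ns k) = card (S \<inter> upper Ns k) + of_bool (Suc h < k)"
    using S by (intro card_insert_inter_upper h j k(1)) auto
  then have "k = Suc h" using k win[OF k(1)] by (cases "h < k"; cases "Suc h < k") auto
  then have "card (S \<inter> upper Ns (Suc h)) < ?M (Suc h)" using k(2) card_j by simp
  moreover have "?M h \<le> card (S \<inter> upper Ns h)" using win[of h] h by simp
  moreover have "?M (Suc (Suc h)) \<le> card (S \<inter> upper Ns (Suc (Suc h))) + 1"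
    using win[of "Suc (Suc h)"] h by simp
  moreover have "card (S \<inter> Ns ! Suc h) < card (Ns ! Suc h)"
    using S j finite_block[OF h] by (intro psubset_card_mono) auto
  ultimately show ?thesis using h length_m by (simp add: sum_list_take_Suc card_inter_upper_Suc)
qed

lemma admissible_if_vector_game:
  assumes W: "W = vector_game N Ns m" and m: "list_all2 (\<le>) m (map card Ns)"
  shows "admissible (map card Ns) m"
proof -
  have length_m: "length m = length Ns" using list_all2_lengthD[OF m] by simp
  have "{} \<notin> W" "N \<in> W" using simple by (auto simp: simple_game_def)
  then have "Ns \<noteq> []" using Union_blocks by auto
  moreover have "0 < m ! 0"
  proof (rule ccontr)
    assume m0: "\<not> 0 < m ! 0"
    then have "length Ns = 1"
      using consecutive_class_bounds[OF W length_m, of 0] \<open>Ns \<noteq> []\<close>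
      by (cases Ns; cases "tl Ns") auto
    then have "m = [0]" using length_m m0 by (cases m) auto
    then have "{} \<in> W" using \<open>length Ns = 1\<close>
      by (auto simp: W vector_game_def dominates_profile take_Cons')
    with \<open>{} \<notin> W\<close> show False ..
  qed
  ultimately show ?thesis
    using m consecutive_class_bounds[OF W length_m] card_block_pos
    by (auto simp: admissible_def in_set_conv_nth)
qed

end

locale admissible_partition = ordered_partition +
  fixes m :: "nat list"
  assumes admissible: "admissible (map card Ns) m"
begin

abbreviation game :: "'a set set" where
  "game \<equiv> vector_game N Ns m"

lemma length_eq: "length m = length Ns"
  and Ns_nonempty: "Ns \<noteq> []"
  and first_entry_pos: "0 < m ! 0"
  and entry_pos: "Suc h < length Ns \<Longrightarrow> 0 < m ! h"
  using admissible by (auto simp: admissible_def dest: list_all2_lengthD)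

lemma entry_le: "h < length Ns \<Longrightarrow> m ! h \<le> card (Ns ! h)"
  using admissible by (auto simp: admissible_def list_all2_conv_all_nth)

lemma entry_less: "h < length Ns \<Longrightarrow> h \<noteq> 0 \<Longrightarrow> m ! h < card (Ns ! h)"
  using admissible by (cases h) (auto simp: admissible_def)

lemma profile_in_game: "T \<subseteq> N \<Longrightarrow> profile Ns T = m \<Longrightarrow> T \<in> game"
  by (simp add: vector_game_def dominates_refl)

lemma coalition_containing:
  assumes "h < length Ns" "i \<in> Ns ! h" "0 < m ! h"
  obtains T where "T \<subseteq> N" "i \<in> T" "profile Ns T = m"
proof -
  have "card ({i} \<inter> Ns ! h') \<le> m ! h'" if "h' < length Ns" for h'
    using assms(3) block_mem_iff[OF assms(1,2) that] by (simp add: Int_insert_left)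
  then show thesis
    using coalition_with_profile[of m "{i}" "{}"] length_eq entry_le assms block_subset that by auto
qed

lemma coalition_avoiding:
  assumes "h < length Ns" "j \<in> Ns ! h" "m ! h < card (Ns ! h)"
  obtains T where "T \<subseteq> N" "j \<notin> T" "profile Ns T = m"
proof -
  have "m ! h' \<le> card (Ns ! h' - {j})" if "h' < length Ns" for h'
    using assms(3) block_mem_iff[OF assms(1,2) that] entry_le[OF that]
    by (cases "h' = h") (simp_all add: card_Diff_singleton_if)
  then show thesis
    using coalition_with_profile[of m "{}" "{j}"] length_eq that by auto
qed

lemma coalition_separating:
  assumes "a < b" "b < length Ns" "i \<in> Ns ! a" "j \<in> Ns ! b"
  obtains T where "T \<subseteq> N" "i \<in> T" "j \<notin> T" "profile Ns T = m"
proof -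
  have a: "a < length Ns" using assms by simp
  have "card ({i} \<inter> Ns ! h) \<le> m ! h" if "h < length Ns" for h
    using entry_pos[of a] assms(1,2) block_mem_iff[OF a assms(3) that]
    by (simp add: Int_insert_left)
  moreover have "m ! h \<le> card (Ns ! h - {j})" if "h < length Ns" for h
    using entry_less[of b] assms(1,2) block_mem_iff[OF assms(2,4) that] entry_le[OF that]
    by (cases "h = b") (simp_all add: card_Diff_singleton_if)
  moreover have "i \<noteq> j" using block_unique[OF a assms(2)] assms by blast
  ultimately show thesis
    using coalition_with_profile[of m "{i}" "{j}"] length_eq block_subset[OF a] assms that by auto
qed

lemma desirable_if_block_le:
  assumes "a \<le> b" "b < length Ns" "i \<in> Ns ! a" "j \<in> Ns ! b"
  shows "desirable N game i j"
  unfolding desirable_def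
proof (intro allI impI)
  fix S assume S: "S \<subseteq> N - {i, j}" "S \<union> {j} \<in> game"
  have a: "a < length Ns" and ij: "i \<notin> S" "j \<notin> S" using assms S by auto
  have "card (insert j S \<inter> upper Ns k) \<le> card (insert i S \<inter> upper Ns k)" if "k \<le> length Ns" for k
    using card_insert_inter_upper[OF a assms(3) ij(1) that]
      card_insert_inter_upper[OF assms(2,4) ij(2) that] \<open>a \<le> b\<close> by simp
  then have "dominates (profile Ns (insert i S)) (profile Ns (insert j S))"
    by (simp add: dominates_profile_profile)
  moreover have "insert i S \<subseteq> N" using S assms block_subset[OF a] by auto
  ultimately show "S \<union> {i} \<in> game"
    using S(2) dominates_trans by (auto simp: vector_game_def)
qed

lemma not_desirable_if_block_less:
  assumes "a < b" "b < length Ns" "i \<in> Ns ! a" "j \<in> Ns ! b"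
  shows "\<not> desirable N game j i"
proof
  assume des: "desirable N game j i"
  have a: "a < length Ns" using assms by simp
  obtain T where T: "T \<subseteq> N" "i \<in> T" "j \<notin> T" "profile Ns T = m"
    using coalition_separating[OF assms] .
  define S where "S = T - {i}"
  have S: "i \<notin> S" "j \<notin> S" "T = insert i S" using T by (auto simp: S_def)
  have "insert i S \<in> game" using profile_in_game T S(3) by blast
  moreover have "S \<subseteq> N - {j, i}" using T S by auto
  ultimately have "insert j S \<in> game" using des by (auto simp: desirable_def)
  then have "dominates (profile Ns (insert j S)) (profile Ns (insert i S))"
    using T(4) S(3) by (simp add: vector_game_def)
  then have "card (insert i S \<inter> upper Ns (Suc a)) \<le> card (insert j S \<inter> upper Ns (Suc a))"
    using a by (simp add: dominates_profile_profile)
  then show False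
    using card_insert_inter_upper[OF a assms(3) S(1), of "Suc a"]
      card_insert_inter_upper[OF assms(2,4) S(2), of "Suc a"] assms(1) a by simp
qed

lemma desir_class_eq_block:
  assumes a: "a < length Ns" "i \<in> Ns ! a"
  shows "desir_equiv N game `` {i} = Ns ! a"
proof (intro equalityI subsetI)
  fix j assume "j \<in> desir_equiv N game `` {i}"
  then have j: "j \<in> N" "desirable N game i j" "desirable N game j i"
    by (auto simp: desir_equiv_def)
  then obtain b where b: "b < length Ns" "j \<in> Ns ! b" using block_mem by blast
  then have "a = b"
    using not_desirable_if_block_less[of a b i j] not_desirable_if_block_less[of b a j i] a j
    by (meson nat_neq_iff)
  then show "j \<in> Ns ! a" using b by simp
next
  fix j assume "j \<in> Ns ! a"
  then show "j \<in> desir_equiv N game `` {i}"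
    using desirable_if_block_le[of a a] a block_subset[OF a(1)] by (auto simp: desir_equiv_def)
qed

lemma class_chain_vector_game: "class_chain N game Ns"
proof -
  have "set Ns = N // desir_equiv N game"
  proof (intro equalityI subsetI)
    fix A assume A: "A \<in> set Ns"
    then obtain a where a: "a < length Ns" "A = Ns ! a" by (auto simp: in_set_conv_nth)
    obtain i where i: "i \<in> A" using block_nonempty[OF A] by blast
    then have "i \<in> N" "A = desir_equiv N game `` {i}"
      using block_subset desir_class_eq_block a by auto
    then show "A \<in> N // desir_equiv N game" by (auto simp: quotient_def)
  next
    fix A assume "A \<in> N // desir_equiv N game"
    then obtain i where i: "i \<in> N" "A = desir_equiv N game `` {i}" by (auto simp: quotient_def)
    then obtain a where "a < length Ns" "i \<in> Ns ! a" using block_mem by blast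
    then show "A \<in> set Ns" using desir_class_eq_block i by simp
  qed
  moreover have "sorted_wrt (class_above N game) Ns"
    unfolding sorted_wrt_iff_nth_less class_above_def strictly_desirable_def
    using desirable_if_block_le not_desirable_if_block_less by (meson less_imp_le)
  ultimately show ?thesis by (simp add: class_chain_def)
qed

lemma simple_vector_game: "simple_game N game"
proof -
  have superset: "S' \<in> game" if "S \<in> game" "S \<subseteq> S'" "S' \<subseteq> N" for S S'
    using that dominates_trans[OF dominates_profile_mono] by (simp add: vector_game_def)
  have "list_all2 (\<le>) m (map card Ns)" using admissible by (simp add: admissible_def)
  then obtain T where "T \<subseteq> N" "profile Ns T = m" using ex_coalition_with_profile by blast
  then have "N \<in> game" using superset profile_in_game by blast
  moreover have "{} \<notin> game"
  proof
    assume "{} \<in> game"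
    moreover have "1 \<le> length Ns" using Ns_nonempty by (simp add: Suc_le_eq)
    ultimately have "sum_list (take 1 m) \<le> card ({} \<inter> upper Ns 1)"
      unfolding vector_game_def dominates_profile by blast
    then show False using first_entry_pos length_eq Ns_nonempty by (cases m) auto
  qed
  ultimately show ?thesis using superset unfolding simple_game_def by (auto simp: vector_game_def)
qed

sublocale ranked_game N game Ns
  using finite_players simple_vector_game class_chain_vector_game by unfold_locales

lemma veto_player_iff:
  assumes h: "h < length Ns" "i \<in> Ns ! h"
  shows "veto_player N game i \<longleftrightarrow> m ! h = card (Ns ! h)"
proof
  assume veto: "veto_player N game i"
  show "m ! h = card (Ns ! h)"
  proof (rule ccontr)
    assume "\<not> ?thesis"
    then obtain T where "T \<subseteq> N" "i \<notin> T" "profile Ns T = m"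
      using coalition_avoiding[OF h] entry_le[OF h(1)] by auto
    then show False using veto profile_in_game by (auto simp: veto_player_def)
  qed
next
  assume full: "m ! h = card (Ns ! h)"
  then have "h = 0" using entry_less[OF h(1)] by auto
  have "i \<in> S" if "S \<in> game" for S
  proof -
    have "1 \<le> length Ns" using h(1) by simp
    then have "sum_list (take 1 m) \<le> card (S \<inter> upper Ns 1)"
      using that unfolding vector_game_def dominates_profile by blast
    then have "card (Ns ! 0) \<le> card (S \<inter> Ns ! 0)"
      using full \<open>h = 0\<close> h(1) length_eq by (simp add: sum_list_take_Suc upper_Suc)
    then have "S \<inter> Ns ! 0 = Ns ! 0"
      using finite_block h(1) \<open>h = 0\<close> by (intro card_seteq) auto
    then show ?thesis using h(2) \<open>h = 0\<close> by blast
  qed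
  then show "veto_player N game i" using h block_subset by (auto simp: veto_player_def)
qed

lemma minimal_winning_profile:
  assumes T: "T \<subseteq> N" "profile Ns T = m"
  shows "minimal_winning game T"
proof -
  have "T' \<notin> game" if "T' \<subset> T" for T'
  proof
    assume "T' \<in> game"
    then have "card T \<le> card T'"
      using dominates_profile_card_le[of T' T] T by (simp add: vector_game_def)
    moreover have "card T' < card T"
      using that T(1) finite_N by (meson finite_subset psubset_card_mono)
    ultimately show False by simp
  qed
  then show ?thesis using profile_in_game T by (auto simp: minimal_winning_def)
qed

lemma winning_remove_last_class:
  assumes S: "S \<in> game" and i: "i \<in> Ns ! (length Ns - 1)" and m: "m ! (length Ns - 1) = 0"
  shows "S - {i} \<in> game"
proof -
  obtain l where l: "length Ns = Suc l" using Ns_nonempty by (cases Ns) auto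
  have above: "sum_list (take k m) \<le> card ((S - {i}) \<inter> upper Ns k)" if "k \<le> l" for k
  proof -
    have "i \<notin> upper Ns k" using mem_upper[of l i k] i l that by simp
    then have "(S - {i}) \<inter> upper Ns k = S \<inter> upper Ns k" by auto
    then show ?thesis using S that l by (simp add: vector_game_def dominates_profile)
  qed
  moreover have "sum_list (take (Suc l) m) \<le> card ((S - {i}) \<inter> upper Ns (Suc l))"
    using above[of l] m l length_eq sum_list_take_Suc[of l m] card_inter_upper_Suc[of l "S - {i}"]
    by simp
  ultimately show ?thesis
    using S l length_eq by (auto simp: vector_game_def dominates_profile le_Suc_eq)
qed

lemma null_player_iff:
  assumes h: "h < length Ns" "i \<in> Ns ! h"
  shows "null_player N game i \<longleftrightarrow> m ! h = 0"
proof
  assume null: "null_player N game i"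
  show "m ! h = 0"
  proof (rule ccontr)
    assume "\<not> ?thesis"
    then obtain T where "T \<subseteq> N" "i \<in> T" "profile Ns T = m" using coalition_containing[OF h] by auto
    then show False using null minimal_winning_profile by (auto simp: null_player_def)
  qed
next
  assume "m ! h = 0"
  moreover from this have "h = length Ns - 1" using entry_pos[of h] h(1) by linarith
  ultimately have "S - {i} \<in> game" if "S \<in> game" for S
    using winning_remove_last_class[OF that] h(2) by simp
  then have "i \<notin> S" if "minimal_winning game S" for S
    using that unfolding minimal_winning_def by blast
  then show "null_player N game i" using h block_subset by (auto simp: null_player_def)
qed

end

subsection \<open>Weightedness\<close>

definition proper_class :: "nat list \<Rightarrow> nat list \<Rightarrow> nat \<Rightarrow> bool" where
  "proper_class ns m h \<longleftrightarrow> h < length ns \<and> 0 < m ! h \<and> m ! h < ns ! h"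

text \<open>
  The instances with \<open>b < c\<close> exclude a third proper class, those with \<open>b = c\<close> restrict the second.
\<close>

definition trade_free :: "nat list \<Rightarrow> nat list \<Rightarrow> bool" where
  "trade_free ns m \<longleftrightarrow>
     (\<forall>a b c. a < b \<and> b \<le> c \<and> proper_class ns m a \<and> proper_class ns m b \<and> proper_class ns m c \<longrightarrow>
        b = c \<and> (m ! b = 1 \<or> Suc (m ! b) = ns ! b))"

lemma trade_freeI:
  assumes "\<And>a b c. a < b \<Longrightarrow> b \<le> c \<Longrightarrow> proper_class ns m a \<Longrightarrow> proper_class ns m b \<Longrightarrow>
    proper_class ns m c \<Longrightarrow> b = c \<and> (m ! b = 1 \<or> Suc (m ! b) = ns ! b)"
  shows "trade_free ns m"
  using assms unfolding trade_free_def by blast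

lemma trade_freeD:
  assumes "trade_free ns m" "a < b" "b \<le> c"
    and "proper_class ns m a" "proper_class ns m b" "proper_class ns m c"
  shows "b = c \<and> (m ! b = 1 \<or> Suc (m ! b) = ns ! b)"
  using assms unfolding trade_free_def by blast

lemma weighted_game_trade:
  assumes "weighted_game N W" "finite N" "S \<in> W" "T \<in> W"
    and trade: "X \<union> Y = S \<union> T" "X \<inter> Y = S \<inter> T"
  shows "X \<in> W \<or> Y \<in> W"
proof -
  obtain w :: "'a \<Rightarrow> real" and q where w: "\<And>S. S \<subseteq> N \<Longrightarrow> S \<in> W \<longleftrightarrow> q \<le> sum w S"
    using assms(1) unfolding weighted_game_def by blast
  have "S \<subseteq> N" "T \<subseteq> N"
    using assms(1,3,4) by (auto simp: weighted_game_def simple_game_def)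
  then have sub: "S \<subseteq> N" "T \<subseteq> N" "X \<subseteq> N" "Y \<subseteq> N" using trade by auto
  then have "finite S" "finite T" "finite X" "finite Y" using assms(2) finite_subset by blast+
  then have "sum w X + sum w Y = sum w S + sum w T"
    using trade by (metis sum.union_inter)
  moreover have "q \<le> sum w S" "q \<le> sum w T" using w sub assms(3,4) by blast+
  ultimately show ?thesis using w sub by fastforce
qed

lemma ex_distinct_pair:
  assumes "A \<noteq> {}" "B \<noteq> {}" "A = B \<and> 2 \<le> card A \<or> A \<inter> B = {}"
  shows "\<exists>x\<in>A. \<exists>y\<in>B. x \<noteq> y"
proof -
  obtain x y where xy: "x \<in> A" "y \<in> B" using assms(1,2) by auto
  show ?thesis
  proof (cases "A \<inter> B = {}")
    case True
    then have "x \<noteq> y" using xy by auto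
    then show ?thesis using xy by blast
  next
    case False
    then have "A = B" "2 \<le> card A" using assms(3) by auto
    then have "\<not> A \<subseteq> {x}" using card_mono[of "{x}" A] by auto
    then show ?thesis using xy(1) \<open>A = B\<close> by auto
  qed
qed

context ordered_partition
begin

text \<open>
  Let \<open>A = T - insert i P\<close>. Trading turns the winning coalitions \<open>T = A \<union> insert i P\<close> and
  \<open>A \<union> insert j Q\<close> into \<open>A \<union> (P \<union> Q)\<close>, which has too few members in the blocks up to \<open>a\<close>, and
  \<open>A \<union> {i, j}\<close>, which has too few members altogether.
\<close>

lemma not_weighted_if_trade:
  assumes T: "T \<subseteq> N" and a: "a < length Ns"
    and i: "i \<in> Ns ! a" "i \<in> T" and j: "j \<in> Ns ! a" "j \<notin> T"
    and P: "P \<subseteq> T" "card P = 2" and Q: "Q \<subseteq> N - T" and PQ: "profile Ns P = profile Ns Q"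
    and below: "P \<inter> upper Ns (Suc a) = {}" "Q \<inter> upper Ns (Suc a) = {}"
  shows "\<not> weighted_game N (vector_game N Ns (profile Ns T))"
proof
  let ?W = "vector_game N Ns (profile Ns T)"
  assume weighted: "weighted_game N ?W"
  define A where "A = T - insert i P"
  have upper: "i \<in> upper Ns (Suc a)" "j \<in> upper Ns (Suc a)" using i j a by (auto simp: upper_Suc)
  then have distinct: "i \<notin> P" "i \<notin> Q" "j \<notin> P" "j \<notin> Q" "i \<noteq> j" using below i(2) j(2) by auto
  have T_eq: "T = A \<union> insert i P" using i P by (auto simp: A_def)
  have sub: "A \<union> insert j Q \<subseteq> N" "A \<union> (P \<union> Q) \<subseteq> N" "A \<union> {i, j} \<subseteq> N"
    using T P Q i(1) j(1) block_subset[OF a] by (auto simp: A_def)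
  have "T \<in> ?W" using T by (simp add: vector_game_def dominates_refl)
  moreover have "profile Ns (A \<union> insert j Q) = profile Ns T"
    unfolding A_def using P(1) Q i(2) j(2) distinct PQ
    by (intro profile_exchange[OF a i(1) j(1)]) auto
  then have "A \<union> insert j Q \<in> ?W" using sub by (simp add: vector_game_def dominates_refl)
  moreover have "(A \<union> (P \<union> Q)) \<inter> upper Ns (Suc a) \<subset> T \<inter> upper Ns (Suc a)"
    using below upper i by (auto simp: A_def)
  then have "A \<union> (P \<union> Q) \<notin> ?W"
    using not_dominates_profile_if_psubset[OF Suc_leI[OF a]] by (auto simp: vector_game_def)
  moreover have "A \<union> {i, j} \<notin> ?W"
  proof -
    have "finite A" "finite P" using T P finite_players by (auto simp: A_def intro: finite_subset)
    moreover have "A \<inter> {i, j} = {}" "A \<inter> insert i P = {}" using j by (auto simp: A_def)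
    ultimately have "card (A \<union> {i, j}) < card T"
      unfolding T_eq using distinct P(2) by (simp add: card_Un_disjoint)
    then show ?thesis using dominates_profile_card_le[OF sub(3) T] by (auto simp: vector_game_def)
  qed
  moreover have "(A \<union> (P \<union> Q)) \<union> (A \<union> {i, j}) = T \<union> (A \<union> insert j Q)"
    "(A \<union> (P \<union> Q)) \<inter> (A \<union> {i, j}) = T \<inter> (A \<union> insert j Q)"
    unfolding T_eq using distinct P Q by (auto simp: A_def)
  ultimately show False
    using weighted_game_trade[OF weighted finite_players] by metis
qed

lemma card_block_Diff:
  "h < length Ns \<Longrightarrow> card (Ns ! h - T) = card (Ns ! h) - card (Ns ! h \<inter> T)"
  using finite_block by (simp add: card_Diff_subset_Int)

lemma proper_class_profileD:
  assumes "proper_class (map card Ns) (profile Ns T) h"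
  shows "Ns ! h \<inter> T \<noteq> {}" and "Ns ! h - T \<noteq> {}"
proof -
  have "0 < card (Ns ! h \<inter> T)" "0 < card (Ns ! h - T)"
    using assms card_block_Diff[of h T] by (auto simp: proper_class_def Int_commute)
  then show "Ns ! h \<inter> T \<noteq> {}" "Ns ! h - T \<noteq> {}" by (metis card.empty less_irrefl)+
qed

lemma proper_class_profile_ge_2:
  assumes "proper_class (map card Ns) (profile Ns T) h"
    and "\<not> (profile Ns T ! h = 1 \<or> Suc (profile Ns T ! h) = map card Ns ! h)"
  shows "2 \<le> card (Ns ! h \<inter> T)" and "2 \<le> card (Ns ! h - T)"
  using assms card_block_Diff[of h T] by (auto simp: proper_class_def Int_commute)

lemma weighted_imp_trade_free:
  assumes weighted: "weighted_game N (vector_game N Ns m)" and m: "list_all2 (\<le>) m (map card Ns)"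
  shows "trade_free (map card Ns) m"
proof (rule trade_freeI, rule ccontr)
  fix a b c
  assume "a < b" "b \<le> c" and proper: "proper_class (map card Ns) m a"
    "proper_class (map card Ns) m b" "proper_class (map card Ns) m c"
    and not_free: "\<not> (b = c \<and> (m ! b = 1 \<or> Suc (m ! b) = map card Ns ! b))"
  have abc: "a < length Ns" "b < length Ns" "c < length Ns"
    using proper by (auto simp: proper_class_def)
  obtain T where T: "T \<subseteq> N" and profile: "m = profile Ns T"
    using ex_coalition_with_profile[OF m] by blast
  note nonempty = proper[unfolded profile, THEN proper_class_profileD(1)]
    proper[unfolded profile, THEN proper_class_profileD(2)]
  have separate: "b = c \<and> 2 \<le> card (Ns ! b \<inter> T) \<and> 2 \<le> card (Ns ! b - T) \<or> Ns ! b \<inter> Ns ! c = {}"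
    using not_free proper(2) proper_class_profile_ge_2[of T b] block_disjoint[OF abc(2,3)]
    unfolding profile by blast
  obtain i j where ij: "i \<in> Ns ! a" "i \<in> T" "j \<in> Ns ! a" "j \<notin> T" using nonempty by blast
  have "\<exists>p\<in>Ns ! b \<inter> T. \<exists>p'\<in>Ns ! c \<inter> T. p \<noteq> p'" "\<exists>q\<in>Ns ! b - T. \<exists>q'\<in>Ns ! c - T. q \<noteq> q'"
    using nonempty separate by (intro ex_distinct_pair; blast)+
  then obtain p p' q q' where p: "p \<in> Ns ! b" "p \<in> T" "p' \<in> Ns ! c" "p' \<in> T" "p \<noteq> p'"
    and q: "q \<in> Ns ! b" "q \<notin> T" "q' \<in> Ns ! c" "q' \<notin> T" "q \<noteq> q'"
    by blast
  have "\<not> weighted_game N (vector_game N Ns (profile Ns T))"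
  proof (rule not_weighted_if_trade[OF T abc(1) ij, of "{p, p'}" "{q, q'}"])
    have "profile Ns {p'} = profile Ns {q'}"
      using profile_insert_cong[OF abc(3) p(3) q(3), of "{}" "{}"] by simp
    then show "profile Ns {p, p'} = profile Ns {q, q'}"
      using profile_insert_cong[OF abc(2) p(1) q(1)] p(5) q(5) by simp
    show "{p, p'} \<inter> upper Ns (Suc a) = {}" "{q, q'} \<inter> upper Ns (Suc a) = {}"
      using mem_upper[OF abc(2), of _ "Suc a"] mem_upper[OF abc(3), of _ "Suc a"] p q abc
        \<open>a < b\<close> \<open>b \<le> c\<close> by auto
  qed (use p q block_subset abc in auto)
  then show False using weighted profile by simp
qed

end

definition vector_weight :: "real list \<Rightarrow> nat list \<Rightarrow> real" where
  "vector_weight v x = (\<Sum>(a, b)\<leftarrow>zip v x. a * real b)"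

text \<open>
  The quota need not be positive, so that the empty vector is weighted; simple games force \<open>0 < q\<close>.
\<close>

definition vector_weighted :: "nat list \<Rightarrow> nat list \<Rightarrow> bool" where
  "vector_weighted ns m \<longleftrightarrow> (\<exists>v q. length v = length ns \<and> (\<forall>a\<in>set v. 0 \<le> a) \<and>
     (\<forall>x. list_all2 (\<le>) x ns \<longrightarrow> (dominates x m \<longleftrightarrow> q \<le> vector_weight v x)))"

lemma vector_weight_Nil [simp]: "vector_weight [] x = 0"
  and vector_weight_Cons [simp]: "vector_weight (a # v) (b # x) = a * real b + vector_weight v x"
  by (simp_all add: vector_weight_def)

lemma vector_weight_snoc:
  "length v = length x \<Longrightarrow> vector_weight (v @ [a]) (x @ [b]) = vector_weight v x + a * real b"
  by (simp add: vector_weight_def)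

lemma vector_weight_mono:
  assumes "list_all2 (\<le>) x y" "length v = length y" "\<forall>a\<in>set v. 0 \<le> a"
  shows "vector_weight v x \<le> vector_weight v y"
  using assms
proof (induction arbitrary: v rule: list_all2_induct)
  case (Cons x xs y ys)
  then obtain a v' where v: "v = a # v'" by (cases v) auto
  have "a * real x \<le> a * real y" using Cons v by (auto intro: mult_left_mono)
  then show ?case using Cons v by (auto intro!: add_mono)
qed (simp add: vector_weight_def)

lemma (in ordered_partition) vector_weighted_imp_weighted_game:
  assumes "vector_weighted (map card Ns) m" and simple: "simple_game N (vector_game N Ns m)"
  shows "weighted_game N (vector_game N Ns m)"
proof -
  obtain v q where v: "length v = length Ns" "\<forall>a\<in>set v. 0 \<le> a"
    and represents: "\<And>x. list_all2 (\<le>) x (map card Ns) \<Longrightarrow> dominates x m \<longleftrightarrow> q \<le> vector_weight v x"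
    using assms(1) unfolding vector_weighted_def length_map by blast
  define w where "w i = (\<Sum>h<length Ns. if i \<in> Ns ! h then v ! h else 0)" for i
  have "0 \<le> w i" for i unfolding w_def using v by (auto intro!: sum_nonneg)
  moreover have win: "S \<in> vector_game N Ns m \<longleftrightarrow> q \<le> sum w S" if "S \<subseteq> N" for S
  proof -
    have "finite S" using that finite_players finite_subset by blast
    have "sum w S = (\<Sum>h<length Ns. \<Sum>i\<in>S. if i \<in> Ns ! h then v ! h else 0)"
      unfolding w_def by (rule sum.swap)
    also have "\<dots> = (\<Sum>h<length Ns. v ! h * real (card (S \<inter> Ns ! h)))"
      using \<open>finite S\<close> by (simp add: sum.inter_restrict[symmetric] mult.commute)
    also have "\<dots> = vector_weight v (profile Ns S)"
      using v(1) by (simp add: vector_weight_def sum_list_sum_nth atLeast0LessThan)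
    finally show ?thesis using represents profile_le_card_blocks that by (simp add: vector_game_def)
  qed
  moreover have "0 < q" using win[of "{}"] simple by (simp add: simple_game_def)
  ultimately show ?thesis unfolding weighted_game_def using simple by blast
qed

lemma vector_weighted_veto:
  assumes "vector_weighted ns m"
  shows "vector_weighted (n # ns) (n # m)"
proof -
  obtain v q where v: "length v = length ns" "\<forall>a\<in>set v. 0 \<le> a"
    and represents: "\<And>x. list_all2 (\<le>) x ns \<Longrightarrow> dominates x m \<longleftrightarrow> q \<le> vector_weight v x"
    using assms unfolding vector_weighted_def by blast
  define u where "u = \<bar>vector_weight v ns\<bar> + \<bar>q\<bar> + 1"
  have "dominates (y # x) (n # m) \<longleftrightarrow> real n * u + q \<le> vector_weight (u # v) (y # x)"
    if "y \<le> n" and x: "list_all2 (\<le>) x ns" for y x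
  proof (cases "y = n")
    case True
    then show ?thesis using x represents by (simp add: dominates_Cons_same mult.commute)
  next
    case False
    then have "(real y + 1) * u \<le> real n * u"
      using \<open>y \<le> n\<close> by (intro mult_right_mono) (simp_all add: u_def)
    moreover have "vector_weight v x \<le> vector_weight v ns" using vector_weight_mono x v by blast
    then have "vector_weight v x < u + q" by (simp add: u_def)
    ultimately have "vector_weight (u # v) (y # x) < real n * u + q"
      by (simp add: algebra_simps)
    then show ?thesis using False \<open>y \<le> n\<close> by (auto dest: dominates_Cons_le)
  qed
  then show ?thesis
    unfolding vector_weighted_def using v
    by (intro exI[of _ "u # v"] exI[of _ "real n * u + q"]) (auto simp: list_all2_Cons2 u_def)
qed

lemma vector_weighted_null:
  assumes "vector_weighted ns m"
  shows "vector_weighted (ns @ [n]) (m @ [0])"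
proof -
  obtain v q where v: "length v = length ns" "\<forall>a\<in>set v. 0 \<le> a"
    and represents: "\<And>x. list_all2 (\<le>) x ns \<Longrightarrow> dominates x m \<longleftrightarrow> q \<le> vector_weight v x"
    using assms unfolding vector_weighted_def by blast
  have "dominates x (m @ [0]) \<longleftrightarrow> q \<le> vector_weight (v @ [0]) x"
    if x: "list_all2 (\<le>) x (ns @ [n])" for x
  proof -
    obtain x' y where "x = x' @ [y]" "list_all2 (\<le>) x' ns"
      using x unfolding list_all2_append2 list_all2_Cons2 by auto
    then show ?thesis
      using represents v(1) list_all2_lengthD[of "(\<le>)" x' ns]
      by (simp add: dominates_snoc_0 vector_weight_snoc)
  qed
  then show ?thesis
    unfolding vector_weighted_def using v
    by (intro exI[of _ "v @ [0]"] exI[of _ q]) auto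
qed

lemma vector_weighted_Nil: "vector_weighted [] []"
  unfolding vector_weighted_def by (auto simp: dominates_refl)

lemma vector_weighted_singleton: "vector_weighted [n] [m]"
  unfolding vector_weighted_def
  by (intro exI[of _ "[1]"] exI[of _ "real m"]) (auto simp: list_all2_Cons2 dominates_singleton)

lemma vector_weighted_pairI:
  fixes u v q :: nat
  assumes "\<And>x y. x \<le> n \<Longrightarrow> y \<le> n' \<Longrightarrow> m \<le> x \<and> m + m' \<le> x + y \<longleftrightarrow> q \<le> u * x + v * y"
  shows "vector_weighted [n, n'] [m, m']"
proof -
  have "dominates z [m, m'] \<longleftrightarrow> real q \<le> vector_weight [real u, real v] z"
    if bounded: "list_all2 (\<le>) z [n, n']" for z
  proof -
    obtain x y where z: "z = [x, y]" "x \<le> n" "y \<le> n'" using bounded by (auto simp: list_all2_Cons2)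
    have "real q \<le> vector_weight [real u, real v] z \<longleftrightarrow> real q \<le> real (u * x + v * y)"
      by (simp add: z(1))
    then show ?thesis using assms[OF z(2,3)] unfolding z(1) dominates_pair of_nat_le_iff by simp
  qed
  then show ?thesis
    unfolding vector_weighted_def
    by (intro exI[of _ "[real u, real v]"] exI[of _ "real q"]) auto
qed

lemma vector_weighted_pair_one:
  assumes "0 < n'"
  shows "vector_weighted [n, n'] [m, 1]"
proof (rule vector_weighted_pairI)
  fix x y assume "y \<le> n'"
  consider "Suc x \<le> m" | "x = m" | "Suc m \<le> x" by linarith
  then show "m \<le> x \<and> m + 1 \<le> x + y \<longleftrightarrow> m * n' + 1 \<le> n' * x + 1 * y"
  proof cases
    case 1
    then have "Suc x * n' \<le> m * n'" by (rule mult_right_mono) simp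
    then show ?thesis using 1 \<open>y \<le> n'\<close> by (simp add: algebra_simps)
  next
    case 3
    then have "Suc m * n' \<le> x * n'" by (rule mult_right_mono) simp
    then show ?thesis using 3 assms by (simp add: algebra_simps)
  qed (simp add: mult.commute)
qed

text \<open>The weights compare the totals \<open>x + y\<close> and break ties by \<open>x\<close>.\<close>

lemma vector_weighted_pair_all_but_one:
  assumes "0 < m" "m \<le> n"
  shows "vector_weighted [n, Suc k] [m, k]"
proof (rule vector_weighted_pairI)
  fix x y assume x: "x \<le> n" and y: "y \<le> Suc k"
  have quota: "m * (n + 2) + k * (n + 1) = (m + k) * (n + 1) + m"
    and weight: "(n + 2) * x + (n + 1) * y = (x + y) * (n + 1) + x" by (simp_all add: algebra_simps)
  consider "Suc (x + y) \<le> m + k" | "x + y = m + k" | "Suc (m + k) \<le> x + y" by linarith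
  then show "m \<le> x \<and> m + k \<le> x + y \<longleftrightarrow> m * (n + 2) + k * (n + 1) \<le> (n + 2) * x + (n + 1) * y"
    unfolding quota weight
  proof cases
    case 1
    then have "Suc (x + y) * (n + 1) \<le> (m + k) * (n + 1)" by (rule mult_right_mono) simp
    then have "(x + y) * (n + 1) + (n + 1) \<le> (m + k) * (n + 1)" by simp
    then show "m \<le> x \<and> m + k \<le> x + y \<longleftrightarrow> (m + k) * (n + 1) + m \<le> (x + y) * (n + 1) + x"
      using 1 x \<open>0 < m\<close> by linarith
  next
    case 2
    then show "m \<le> x \<and> m + k \<le> x + y \<longleftrightarrow> (m + k) * (n + 1) + m \<le> (x + y) * (n + 1) + x" by simp
  next
    case 3
    then have "Suc (m + k) * (n + 1) \<le> (x + y) * (n + 1)" by (rule mult_right_mono) simp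
    then have "(m + k) * (n + 1) + (n + 1) \<le> (x + y) * (n + 1)" by simp
    then show "m \<le> x \<and> m + k \<le> x + y \<longleftrightarrow> (m + k) * (n + 1) + m \<le> (x + y) * (n + 1) + x"
      using 3 y \<open>m \<le> n\<close> by linarith
  qed
qed

subsection \<open>Veto and null classes\<close>

definition all_proper :: "nat list \<Rightarrow> nat list \<Rightarrow> bool" where
  "all_proper ns m \<longleftrightarrow> list_all2 (\<lambda>a c. 0 < c \<and> c < a) ns m"

lemma all_proper_length: "all_proper ns m \<Longrightarrow> length m = length ns"
  unfolding all_proper_def by (metis list_all2_lengthD)

lemma all_proper_Nil [simp]: "all_proper [] m \<longleftrightarrow> m = []" "all_proper ns [] \<longleftrightarrow> ns = []"
  and all_proper_Cons_Cons [simp]: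
    "all_proper (a # ns) (c # m) \<longleftrightarrow> 0 < c \<and> c < a \<and> all_proper ns m"
  by (auto simp: all_proper_def)

lemma all_proper_Cons1:
  "all_proper (a # ns) m \<longleftrightarrow> (\<exists>c m'. m = c # m' \<and> 0 < c \<and> c < a \<and> all_proper ns m')"
  by (auto simp: all_proper_def list_all2_Cons1)

lemma all_proper_0_notin: "all_proper ns m \<Longrightarrow> 0 \<notin> set m"
  by (auto simp: all_proper_def list_all2_conv_all_nth in_set_conv_nth)

lemma all_proper_snoc_snoc [simp]:
  "all_proper (ns @ [b]) (m @ [d]) \<longleftrightarrow> all_proper ns m \<and> 0 < d \<and> d < b"
  using list_all2_rev[of "\<lambda>a c. 0 < c \<and> c < a" "ns @ [b]" "m @ [d]"] by (auto simp: all_proper_def)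

lemma all_proper_iff_proper_class:
  "all_proper ns m \<longleftrightarrow> length m = length ns \<and> (\<forall>h<length ns. proper_class ns m h)"
  by (auto simp: all_proper_def proper_class_def list_all2_conv_all_nth)

lemma trade_free_veto: "trade_free (n # ns) (n # m) \<longleftrightarrow> trade_free ns m"
proof -
  have Suc: "proper_class (n # ns) (n # m) (Suc h) \<longleftrightarrow> proper_class ns m h" for h
    by (simp add: proper_class_def)
  have not_0: "\<not> proper_class (n # ns) (n # m) 0" by (simp add: proper_class_def)
  show ?thesis
  proof
    assume free: "trade_free (n # ns) (n # m)"
    show "trade_free ns m"
    proof (rule trade_freeI)
      fix a b c
      assume "a < b" "b \<le> c" "proper_class ns m a" "proper_class ns m b" "proper_class ns m c"
      then show "b = c \<and> (m ! b = 1 \<or> Suc (m ! b) = ns ! b)"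
        using trade_freeD[OF free, of "Suc a" "Suc b" "Suc c"] by (auto simp: Suc)
    qed
  next
    assume free: "trade_free ns m"
    show "trade_free (n # ns) (n # m)"
    proof (rule trade_freeI)
      fix a b c
      assume "a < b" "b \<le> c" "proper_class (n # ns) (n # m) a" "proper_class (n # ns) (n # m) b"
        "proper_class (n # ns) (n # m) c"
      then show "b = c \<and> ((n # m) ! b = 1 \<or> Suc ((n # m) ! b) = (n # ns) ! b)"
        using trade_freeD[OF free, of "a - 1" "b - 1" "c - 1"] Suc not_0
        by (cases a; cases b; cases c) simp_all
    qed
  qed
qed

lemma trade_free_null:
  assumes "length m = length ns"
  shows "trade_free (ns @ [n]) (m @ [0]) \<longleftrightarrow> trade_free ns m"
proof -
  have "proper_class (ns @ [n]) (m @ [0]) h \<longleftrightarrow> proper_class ns m h" for h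
    using assms by (auto simp: proper_class_def nth_append less_Suc_eq)
  moreover have "(ns @ [n]) ! h = ns ! h" "(m @ [0]) ! h = m ! h" if "proper_class ns m h" for h
    using that assms by (auto simp: proper_class_def nth_append)
  ultimately show ?thesis unfolding trade_free_def by metis
qed

lemma all_proper_trade_free_length:
  assumes "all_proper ns m" "trade_free ns m"
  shows "length ns \<le> 2"
proof (rule ccontr)
  assume "\<not> ?thesis"
  then have proper: "proper_class ns m h" if "h \<le> 2" for h
    using that assms(1) by (simp add: all_proper_iff_proper_class)
  show False
    using trade_freeD[OF assms(2), of 0 1 2] proper by simp
qed

lemma trade_free_if_length_le_1: "length ns \<le> 1 \<Longrightarrow> trade_free ns m"
  by (auto simp: trade_free_def proper_class_def)

lemma trade_free_pair:
  assumes "all_proper [a, b] [c, d]"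
  shows "trade_free [a, b] [c, d] \<longleftrightarrow> d = 1 \<or> Suc d = b"
proof -
  have "proper_class [a, b] [c, d] h \<longleftrightarrow> h < 2" for h
    using assms by (auto simp: proper_class_def less_Suc_eq numeral_2_eq_2)
  then have "i < j \<and> j \<le> k \<and> proper_class [a, b] [c, d] i \<and> proper_class [a, b] [c, d] j \<and>
      proper_class [a, b] [c, d] k \<longleftrightarrow> i = 0 \<and> j = 1 \<and> k = 1" for i j k
    by (simp only:) arith
  then show ?thesis by (simp add: trade_free_def)
qed

definition nonveto :: "nat list \<Rightarrow> nat list \<Rightarrow> bool" where
  "nonveto ns m \<longleftrightarrow> list_all2 (<) m ns \<and> (\<forall>h. Suc h < length ns \<longrightarrow> 0 < m ! h)"

lemma admissible_Cons_Cons: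
  "admissible (a # ns) (c # m) \<longleftrightarrow> 0 < c \<and> c \<le> a \<and> nonveto ns m"
proof
  assume admissible: "admissible (a # ns) (c # m)"
  then have "0 < (c # m) ! h \<and> m ! h < ns ! h" if "h < length ns" for h
    using that by (auto simp: admissible_def)
  from this this[of "Suc h" for h] show "0 < c \<and> c \<le> a \<and> nonveto ns m"
    using admissible by (auto simp: admissible_def nonveto_def list_all2_conv_all_nth)
next
  assume bounds: "0 < c \<and> c \<le> a \<and> nonveto ns m"
  then have less: "m ! h < ns ! h" if "h < length ns" for h
    using that by (simp add: nonveto_def list_all2_conv_all_nth)
  then have "\<forall>b\<in>set ns. 0 < b" by (metis in_set_conv_nth gr_zeroI not_less_zero)
  moreover have "list_all2 (\<le>) m ns" using bounds by (auto simp: nonveto_def elim: list_all2_mono)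
  ultimately show "admissible (a # ns) (c # m)"
    using bounds less by (auto simp: admissible_def nonveto_def nth_Cons')
qed

lemma nonveto_snoc_snoc:
  "nonveto (ns @ [b]) (m @ [d]) \<longleftrightarrow> all_proper ns m \<and> d < b"
proof (cases "length m = length ns")
  case True
  then have "(\<forall>h. Suc h < length (ns @ [b]) \<longrightarrow> 0 < (m @ [d]) ! h) \<longleftrightarrow> (\<forall>h<length ns. 0 < m ! h)"
    by (simp add: nth_append)
  moreover have "list_all2 (<) (m @ [d]) (ns @ [b]) \<longleftrightarrow> list_all2 (<) m ns \<and> d < b"
    using list_all2_append[OF True] by simp
  moreover have "all_proper ns m \<longleftrightarrow> list_all2 (<) m ns \<and> (\<forall>h<length ns. 0 < m ! h)"
    using True by (auto simp: all_proper_def list_all2_conv_all_nth)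
  ultimately show ?thesis unfolding nonveto_def by blast
next
  case False
  then show ?thesis by (auto simp: nonveto_def all_proper_def dest: list_all2_lengthD)
qed

lemma nonveto_iff:
  "nonveto ns m \<longleftrightarrow> all_proper ns m \<or>
     (\<exists>b ns' m'. ns = ns' @ [b] \<and> m = m' @ [0] \<and> 0 < b \<and> all_proper ns' m')"
proof (cases ns rule: rev_cases)
  case Nil
  then show ?thesis by (simp add: nonveto_def)
next
  case (snoc ns' b)
  show ?thesis
  proof (cases m rule: rev_cases)
    case Nil
    then show ?thesis using snoc by (auto simp: nonveto_def all_proper_def)
  next
    case (snoc m' d)
    then show ?thesis using \<open>ns = ns' @ [b]\<close> by (auto simp: nonveto_snoc_snoc)
  qed
qed

lemma admissible_iff:
  "admissible ns m \<longleftrightarrow>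
     ns \<noteq> [] \<and> all_proper ns m \<or>
     (\<exists>a ns' m'. ns = a # ns' \<and> m = a # m' \<and> 0 < a \<and> all_proper ns' m') \<or>
     (\<exists>b ns' m'. ns = ns' @ [b] \<and> m = m' @ [0] \<and> 0 < b \<and> ns' \<noteq> [] \<and> all_proper ns' m') \<or>
     (\<exists>a b ns' m'. ns = a # ns' @ [b] \<and> m = a # m' @ [0] \<and> 0 < a \<and> 0 < b \<and> all_proper ns' m')"
proof (cases "ns = [] \<or> m = []")
  case True
  then show ?thesis by (auto simp: admissible_def all_proper_def)
next
  case False
  then obtain a ns_tl c m_tl where Cons: "ns = a # ns_tl" "m = c # m_tl" by (metis neq_Nil_conv)
  show ?thesis
    unfolding Cons admissible_Cons_Cons nonveto_iff by (auto simp: Cons_eq_append_conv)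
qed

lemma all_proper_trade_free_vector_weighted:
  assumes proper: "all_proper ns m" and free: "trade_free ns m"
  shows "vector_weighted ns m"
proof -
  have "length ns \<le> 2" "length m = length ns"
    using all_proper_trade_free_length[OF assms] all_proper_length[OF proper] .
  then consider "ns = []" "m = []" | a c where "ns = [a]" "m = [c]"
    | a b c d where "ns = [a, b]" "m = [c, d]"
    by (auto simp: le_Suc_eq numeral_2_eq_2 length_Suc_conv)
  then show ?thesis
  proof cases
    case 3
    then have "0 < c" "c < a" "0 < b" "d = 1 \<or> b = Suc d"
      using proper free trade_free_pair by auto
    then show ?thesis
      using 3 vector_weighted_pair_one vector_weighted_pair_all_but_one by auto
  qed (simp_all add: vector_weighted_Nil vector_weighted_singleton)
qed

lemma admissible_trade_free_vector_weighted:
  assumes "admissible ns m" "trade_free ns m"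
  shows "vector_weighted ns m"
  using assms unfolding admissible_iff
  by (elim disjE exE conjE)
    (auto simp: trade_free_veto trade_free_null all_proper_length
      intro!: vector_weighted_veto vector_weighted_null all_proper_trade_free_vector_weighted)

context admissible_partition
begin

lemma weighted_game_iff: "weighted_game N game \<longleftrightarrow> trade_free (map card Ns) m"
proof
  assume "weighted_game N game"
  then show "trade_free (map card Ns) m"
    using weighted_imp_trade_free admissible by (simp add: admissible_def)
next
  assume "trade_free (map card Ns) m"
  then show "weighted_game N game"
    using vector_weighted_imp_weighted_game simple_vector_game
      admissible_trade_free_vector_weighted[OF admissible] by blast
qed

lemma nontrivial_game_iff: "nontrivial_game N game \<longleftrightarrow> all_proper (map card Ns) m"
proof -
  have "nontrivial_game N game \<longleftrightarrow>
      (\<forall>h<length Ns. \<forall>i\<in>Ns ! h. \<not> veto_player N game i \<and> \<not> null_player N game i)"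
    unfolding nontrivial_game_def using block_mem block_subset by blast
  also have "\<dots> \<longleftrightarrow> (\<forall>h<length Ns. 0 < m ! h \<and> m ! h < card (Ns ! h))"
  proof (intro all_cong)
    fix h assume h: "h < length Ns"
    then have "Ns ! h \<noteq> {}" using card_block_pos by fastforce
    then show "(\<forall>i\<in>Ns ! h. \<not> veto_player N game i \<and> \<not> null_player N game i) \<longleftrightarrow>
        0 < m ! h \<and> m ! h < card (Ns ! h)"
      using entry_le[OF h] by (auto simp: veto_player_iff[OF h] null_player_iff[OF h])
  qed
  also have "\<dots> \<longleftrightarrow> all_proper (map card Ns) m"
    by (simp add: all_proper_def list_all2_conv_all_nth length_eq)
  finally show ?thesis .
qed

end

subsection \<open>Isomorphism\<close>

lemma game_iso_iff:
  "(W, W') \<in> game_iso N \<longleftrightarrow>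
     simple_game N W \<and> simple_game N W' \<and> (\<exists>f. bij_betw f N N \<and> W' = (`) f ` W)"
proof (cases "simple_game N W \<and> simple_game N W'")
  case True
  then have sub: "W \<subseteq> Pow N" "W' \<subseteq> Pow N" by (auto simp: simple_game_def)
  have "(\<forall>S. S \<subseteq> N \<longrightarrow> (S \<in> W \<longleftrightarrow> f ` S \<in> W')) \<longleftrightarrow> W' = (`) f ` W" if f: "bij_betw f N N" for f
  proof
    assume preserved: "\<forall>S. S \<subseteq> N \<longrightarrow> (S \<in> W \<longleftrightarrow> f ` S \<in> W')"
    show "W' = (`) f ` W"
    proof (intro equalityI subsetI)
      fix S' assume S': "S' \<in> W'"
      then obtain S where "S \<subseteq> N" "S' = f ` S"
        using sub(2) f by (metis PowD bij_betw_imp_surj_on in_mono subset_imageE)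
      then show "S' \<in> (`) f ` W" using preserved S' by blast
    qed (use preserved sub(1) in blast)
  next
    assume W': "W' = (`) f ` W"
    have "S \<in> W" if "S \<subseteq> N" and image: "f ` S \<in> (`) f ` W" for S
    proof -
      obtain T where "T \<in> W" "f ` S = f ` T" using image by blast
      moreover from this have "T \<subseteq> N" using sub(1) by blast
      ultimately show ?thesis
        using inj_on_image_eq_iff[OF bij_betw_imp_inj_on[OF f] \<open>S \<subseteq> N\<close>, of T] by simp
    qed
    then show "\<forall>S. S \<subseteq> N \<longrightarrow> (S \<in> W \<longleftrightarrow> f ` S \<in> W')" unfolding W' by blast
  qed
  then show ?thesis using True by (simp add: game_iso_def cong: conj_cong)
qed (auto simp: game_iso_def)

lemma equiv_game_iso: "equiv {W. simple_game N W} (game_iso N)"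
proof (rule equivI)
  show "game_iso N \<subseteq> {W. simple_game N W} \<times> {W. simple_game N W}"
    by (auto simp: game_iso_iff)
  show "refl_on {W. simple_game N W} (game_iso N)"
    by (auto simp: refl_on_def game_iso_iff intro!: exI[of _ id])
  show "sym (game_iso N)"
  proof (rule symI)
    fix W W' assume "(W, W') \<in> game_iso N"
    then obtain f where f: "bij_betw f N N" "W' = (`) f ` W"
      and game: "simple_game N W" "simple_game N W'" by (auto simp: game_iso_iff)
    have "inv_into N f ` f ` S = S" if "S \<in> W" for S
    proof -
      have "S \<subseteq> N" using game(1) that by (auto simp: simple_game_def)
      then show ?thesis using bij_betw_imp_inj_on[OF f(1)] by simp
    qed
    then have "W = (`) (inv_into N f) ` W'" unfolding f(2) image_image by simp
    then show "(W', W) \<in> game_iso N"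
      using game bij_betw_inv_into[OF f(1)] by (auto simp: game_iso_iff)
  qed
  show "trans (game_iso N)"
  proof (rule transI)
    fix W1 W2 W3 assume "(W1, W2) \<in> game_iso N" "(W2, W3) \<in> game_iso N"
    then obtain f g where fg: "bij_betw f N N" "bij_betw g N N"
      and W3: "W3 = (`) (g \<circ> f) ` W1" and game: "simple_game N W1" "simple_game N W3"
      by (auto simp: game_iso_iff image_comp comp_def)
    then show "(W1, W3) \<in> game_iso N"
      using bij_betw_trans[OF fg] by (auto simp: game_iso_iff)
  qed
qed

context ordered_partition
begin

context
  fixes f :: "'a \<Rightarrow> 'b" and M :: "'b set"
  assumes f: "bij_betw f N M"
begin

lemma image_inter_block:
  assumes "S \<subseteq> N" "h < length Ns"
  shows "f ` S \<inter> f ` (Ns ! h) = f ` (S \<inter> Ns ! h)"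
  using inj_on_image_Int[OF bij_betw_imp_inj_on[OF f] assms(1) block_subset[OF assms(2)]] by simp

lemma card_image_coalition: "S \<subseteq> N \<Longrightarrow> card (f ` S) = card S"
  by (rule card_image[OF inj_on_subset[OF bij_betw_imp_inj_on[OF f]]])

lemma ordered_partition_image: "ordered_partition M (map ((`) f) Ns)"
proof
  show "finite M" using f finite_players bij_betw_finite by blast
  show "\<Union> (set (map ((`) f) Ns)) = M"
    using bij_betw_imp_surj_on[OF f] Union_blocks by (metis image_Union set_map)
  show "A \<noteq> {}" if "A \<in> set (map ((`) f) Ns)" for A using that block_nonempty by auto
  show "map ((`) f) Ns ! a \<inter> map ((`) f) Ns ! b = {}"
    if "a < length (map ((`) f) Ns)" "b < length (map ((`) f) Ns)" "a \<noteq> b" for a b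
    using that image_inter_block[OF block_subset, of a b] block_disjoint[of a b] by simp
qed

lemma map_card_image: "map card (map ((`) f) Ns) = map card Ns"
  using block_subset card_image_coalition by (auto simp: in_set_conv_nth)

lemma profile_image: "S \<subseteq> N \<Longrightarrow> profile (map ((`) f) Ns) (f ` S) = profile Ns S"
  by (rule nth_equalityI) (auto simp: image_inter_block card_image_coalition le_infI1)

lemma vector_game_image: "vector_game M (map ((`) f) Ns) m = (`) f ` vector_game N Ns m"
proof (intro equalityI subsetI)
  fix S' assume S': "S' \<in> vector_game M (map ((`) f) Ns) m"
  then obtain S where "S \<subseteq> N" "S' = f ` S"
    using bij_betw_imp_surj_on[OF f] by (auto simp: vector_game_def elim: subset_imageE)
  with S' show "S' \<in> (`) f ` vector_game N Ns m" by (auto simp: vector_game_def profile_image)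
next
  fix S' assume "S' \<in> (`) f ` vector_game N Ns m"
  then show "S' \<in> vector_game M (map ((`) f) Ns) m"
    using bij_betw_imp_surj_on[OF f] by (auto simp: vector_game_def profile_image)
qed

end

end

lemma ex_block_bijection:
  assumes "ordered_partition N Ns" "ordered_partition M Ms" "map card Ns = map card Ms"
  shows "\<exists>f. bij_betw f N M \<and> map ((`) f) Ns = Ms"
proof -
  interpret A: ordered_partition N Ns by fact
  interpret B: ordered_partition M Ms by fact
  have same_length: "length Ns = length Ms" using assms(3) map_eq_imp_length_eq by blast
  have "\<exists>g. bij_betw g (Ns ! h) (Ms ! h)" if "h < length Ns" for h
    using that same_length A.finite_block B.finite_block assms(3)
    by (metis finite_same_card_bij nth_map)
  then obtain g where g: "\<And>h. h < length Ns \<Longrightarrow> bij_betw (g h) (Ns ! h) (Ms ! h)" by metis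
  define f where "f i = g (THE h. h < length Ns \<and> i \<in> Ns ! h) i" for i
  have f: "f i = g h i" if "h < length Ns" "i \<in> Ns ! h" for h i
  proof -
    have "(THE h. h < length Ns \<and> i \<in> Ns ! h) = h"
      using that A.block_unique by (intro the_equality) blast+
    then show ?thesis by (simp add: f_def)
  qed
  have image: "f ` (Ns ! h) = Ms ! h" if "h < length Ns" for h
    using f[OF that] g[OF that] by (auto simp: bij_betw_def)
  then have map: "map ((`) f) Ns = Ms" using same_length by (intro nth_equalityI) auto
  then have "f ` N = M" using A.Union_blocks B.Union_blocks by (metis image_Union set_map)
  moreover have "inj_on f N"
  proof (rule inj_onI)
    fix i j assume ij: "i \<in> N" "j \<in> N" "f i = f j"
    then obtain a b where ab: "a < length Ns" "i \<in> Ns ! a" "b < length Ns" "j \<in> Ns ! b"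
      using A.block_mem by blast
    then have "f i \<in> Ms ! a" "f i \<in> Ms ! b" using image ij(3) by blast+
    then have "a = b" using B.block_unique ab same_length by simp
    then show "i = j" using f ab ij(3) g[OF ab(1)] by (auto simp: bij_betw_def dest: inj_onD)
  qed
  ultimately show ?thesis using map by (auto simp: bij_betw_def)
qed

lemma ex_ordered_partition_with_sizes:
  assumes "finite N" "card N = sum_list ns" "\<forall>a\<in>set ns. 0 < a"
  shows "\<exists>Ns. ordered_partition N Ns \<and> map card Ns = ns"
  using assms
proof (induction ns arbitrary: N)
  case Nil
  then have "ordered_partition N []" by unfold_locales auto
  then show ?case by auto
next
  case (Cons a ns)
  obtain A where A: "A \<subseteq> N" "card A = a" "finite A"
    using obtain_subset_with_card_n[of a N] Cons.prems by auto
  have "card (N - A) = sum_list ns" using A Cons.prems by (simp add: card_Diff_subset)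
  then obtain Ns where "ordered_partition (N - A) Ns" and Ns: "map card Ns = ns"
    using Cons.IH[of "N - A"] Cons.prems by auto
  then interpret ordered_partition "N - A" Ns by simp
  have "A \<noteq> {}" using A Cons.prems by auto
  have "ordered_partition N (A # Ns)"
  proof
    show "finite N" by fact
    show "\<Union> (set (A # Ns)) = N" using Union_blocks A by auto
    show "B \<noteq> {}" if "B \<in> set (A # Ns)" for B using that \<open>A \<noteq> {}\<close> block_nonempty by auto
    show "(A # Ns) ! b \<inter> (A # Ns) ! c = {}"
      if "b < length (A # Ns)" "c < length (A # Ns)" "b \<noteq> c" for b c
      using that block_disjoint[of "b - 1" "c - 1"]
        block_subset[of "b - 1"] block_subset[of "c - 1"]
      by (cases b; cases c) auto
  qed
  then show ?case using Ns A by (intro exI[of _ "A # Ns"]) simp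
qed

lemma game_iso_vector_game_iff:
  assumes "admissible_partition N Ns m" "admissible_partition N Ns' m'"
  shows "(vector_game N Ns m, vector_game N Ns' m') \<in> game_iso N \<longleftrightarrow>
    map card Ns = map card Ns' \<and> m = m'"
proof -
  interpret A: admissible_partition N Ns m by fact
  interpret B: admissible_partition N Ns' m' by fact
  show ?thesis
  proof
    assume "(A.game, B.game) \<in> game_iso N"
    then obtain f where f: "bij_betw f N N" and "B.game = (`) f ` A.game"
      by (auto simp: game_iso_iff)
    then have game: "B.game = vector_game N (map ((`) f) Ns) m"
      using A.vector_game_image by metis
    interpret M: admissible_partition N "map ((`) f) Ns" m
      by (intro admissible_partition.intro admissible_partition_axioms.intro
          A.ordered_partition_image[OF f]) (simp only: A.map_card_image[OF f] A.admissible)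
    have M: "map ((`) f) Ns = Ns'"
      using class_chain_unique M.class_chain_vector_game B.class_chain_vector_game
      unfolding game by blast
    then have sizes: "map card Ns = map card Ns'" using A.map_card_image[OF f] by simp
    have "{m. shift_minimal_winning N B.game m} = {m'}"
      using B.admissible B.unique_shift_minimal_iff by (simp add: admissible_def)
    moreover have "{m. shift_minimal_winning N B.game m} = {m}"
      using A.admissible B.unique_shift_minimal_iff game M sizes by (simp add: admissible_def)
    ultimately show "map card Ns = map card Ns' \<and> m = m'" using sizes by simp
  next
    assume same_params: "map card Ns = map card Ns' \<and> m = m'"
    then obtain f where "bij_betw f N N" "map ((`) f) Ns = Ns'"
      using ex_block_bijection A.ordered_partition_axioms B.ordered_partition_axioms by blast
    then have "B.game = (`) f ` A.game" using A.vector_game_image same_params by metis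
    then show "(A.game, B.game) \<in> game_iso N"
      using \<open>bij_betw f N N\<close> A.simple_vector_game B.simple_vector_game by (auto simp: game_iso_iff)
  qed
qed

lemma card_image_eq_if_eq_iff:
  assumes "\<And>x y. x \<in> A \<Longrightarrow> y \<in> A \<Longrightarrow> f x = f y \<longleftrightarrow> g x = g y"
  shows "card (f ` A) = card (g ` A)"
proof (rule bij_betw_same_card)
  have inv: "inv_into A f u \<in> A" "f (inv_into A f u) = u" if "u \<in> f ` A" for u
    using that by (auto intro: inv_into_into f_inv_into_f)
  have "g (inv_into A f (f x)) = g x" if "x \<in> A" for x
    using inv[of "f x"] assms[of "inv_into A f (f x)" x] that by simp
  then have "(\<lambda>u. g (inv_into A f u)) ` f ` A = g ` A" by (auto simp: image_image)
  moreover have "inj_on (\<lambda>u. g (inv_into A f u)) (f ` A)"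
    using inv assms by (intro inj_onI) metis
  ultimately show "bij_betw (\<lambda>u. g (inv_into A f u)) (f ` A) (g ` A)" by (simp add: bij_betw_def)
qed

definition vector_games :: "'a set \<Rightarrow> (nat list \<times> nat list) set \<Rightarrow> 'a set set set" where
  "vector_games N P = {vector_game N Ns m | Ns m. ordered_partition N Ns \<and> (map card Ns, m) \<in> P}"

lemma card_vector_games_quotient:
  assumes "finite N" and P: "\<And>ns m. (ns, m) \<in> P \<Longrightarrow> sum_list ns = card N \<and> admissible ns m"
  shows "card (vector_games N P // game_iso N) = card P"
proof -
  let ?Q = "{(Ns, m). ordered_partition N Ns \<and> (map card Ns, m) \<in> P}"
  let ?iso_class = "\<lambda>(Ns, m). game_iso N `` {vector_game N Ns m}"
  let ?params = "\<lambda>(Ns, m). (map card Ns, m)"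
  have admissible: "admissible_partition N Ns m" if "(Ns, m) \<in> ?Q" for Ns m
    using that P by (auto simp: admissible_partition_def admissible_partition_axioms_def)
  have "?iso_class x = ?iso_class y \<longleftrightarrow> ?params x = ?params y" if "x \<in> ?Q" "y \<in> ?Q" for x y
  proof -
    obtain Ns m Ns' m' where xy: "x = (Ns, m)" "y = (Ns', m')" by (metis surj_pair)
    interpret A: admissible_partition N Ns m using admissible that(1) xy by blast
    interpret B: admissible_partition N Ns' m' using admissible that(2) xy by blast
    show ?thesis
      using eq_equiv_class_iff[OF equiv_game_iso, of A.game N B.game]
        A.simple_vector_game B.simple_vector_game
        game_iso_vector_game_iff[OF A.admissible_partition_axioms B.admissible_partition_axioms]
      by (simp add: xy)
  qed
  then have "card (?iso_class ` ?Q) = card (?params ` ?Q)" by (rule card_image_eq_if_eq_iff)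
  moreover have "?iso_class ` ?Q = vector_games N P // game_iso N"
    by (auto simp: vector_games_def quotient_def)
  moreover have "?params ` ?Q = P"
  proof (intro equalityI subsetI)
    fix p assume p: "p \<in> P"
    obtain ns m where ns: "p = (ns, m)" by (cases p)
    then have "card N = sum_list ns" "\<forall>a\<in>set ns. 0 < a"
      using P p by (auto simp: admissible_def)
    then obtain Ns where "ordered_partition N Ns" "map card Ns = ns"
      using ex_ordered_partition_with_sizes[OF assms(1)] by blast
    then show "p \<in> ?params ` ?Q" using p ns by (intro image_eqI[of _ _ "(Ns, m)"]) auto
  qed auto
  ultimately show ?thesis by simp
qed

lemma nontrivial_vector_games:
  assumes "\<And>ns m. (ns, m) \<in> P \<Longrightarrow> admissible ns m"
  shows "{W \<in> vector_games N P. nontrivial_game N W} =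
    vector_games N {(ns, m) \<in> P. all_proper ns m}"
proof -
  have "nontrivial_game N (vector_game N Ns m) \<longleftrightarrow> all_proper (map card Ns) m"
    if "ordered_partition N Ns" "(map card Ns, m) \<in> P" for Ns m
  proof -
    interpret admissible_partition N Ns m
      using that assms by (simp add: admissible_partition_def admissible_partition_axioms_def)
    show ?thesis by (rule nontrivial_game_iff)
  qed
  then show ?thesis by (auto simp: vector_games_def)
qed

definition weighted_params :: "nat \<Rightarrow> nat \<Rightarrow> (nat list \<times> nat list) set" where
  "weighted_params t n =
     {(ns, m). length ns = t \<and> sum_list ns = n \<and> admissible ns m \<and> trade_free ns m}"

definition proper_params :: "nat \<Rightarrow> nat \<Rightarrow> (nat list \<times> nat list) set" where
  "proper_params t n =
     {(ns, m). length ns = t \<and> sum_list ns = n \<and> all_proper ns m \<and> trade_free ns m}"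

lemma weighted_games_unique_shift_minimal:
  "weighted_games n t 1 = vector_games {1..n} (weighted_params t n)"
proof (intro equalityI subsetI)
  fix W assume "W \<in> weighted_games n t 1"
  then have weighted: "weighted_game {1..n} W" and t: "card ({1..n} // desir_equiv {1..n} W) = t"
    and "card {m. shift_minimal_winning {1..n} W m} = 1"
    by (auto simp: weighted_games_def)
  then obtain m where unique: "{m. shift_minimal_winning {1..n} W m} = {m}"
    using card_1_singletonE by blast
  obtain Ns where "class_chain {1..n} W Ns"
    using ex_class_chain weighted_game_desirable_total[OF weighted] by (metis finite_atLeastAtMost)
  with weighted interpret ranked_game "{1..n}" W Ns
    by unfold_locales (auto simp: weighted_game_def)
  have W: "W = vector_game {1..n} Ns m" and m: "list_all2 (\<le>) m (map card Ns)"
    using unique unfolding unique_shift_minimal_iff by auto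
  then have admissible_sizes: "admissible (map card Ns) m" by (intro admissible_if_vector_game)
  have "trade_free (map card Ns) m"
    using weighted_imp_trade_free weighted m unfolding W by blast
  then have "(map card Ns, m) \<in> weighted_params t n"
    using admissible_sizes t card_desir_classes sum_list_card_blocks
    by (simp add: weighted_params_def)
  then show "W \<in> vector_games {1..n} (weighted_params t n)"
    using W ordered_partition_axioms by (auto simp: vector_games_def)
next
  fix W assume "W \<in> vector_games {1..n} (weighted_params t n)"
  then obtain Ns m where W: "W = vector_game {1..n} Ns m" and "ordered_partition {1..n} Ns"
    and "length Ns = t" "admissible (map card Ns) m" "trade_free (map card Ns) m"
    by (auto simp: vector_games_def weighted_params_def)
  interpret admissible_partition "{1..n}" Ns m
    by (intro admissible_partition.intro admissible_partition_axioms.intro) fact+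
  have "{m. shift_minimal_winning {1..n} game m} = {m}"
    using admissible unique_shift_minimal_iff by (simp add: admissible_def)
  then show "W \<in> weighted_games n t 1"
    using weighted_game_iff \<open>trade_free _ m\<close> card_desir_classes \<open>length Ns = t\<close>
    by (simp add: W weighted_games_def)
qed

lemma wg_eq_card_weighted_params: "wg n t 1 = card (weighted_params t n)"
  unfolding wg_def weighted_games_unique_shift_minimal
  by (rule card_vector_games_quotient) (auto simp: weighted_params_def)

lemma wg_hat_eq_card_proper_params:
  assumes "0 < t"
  shows "wg_hat n t 1 = card (proper_params t n)"
proof -
  have "{(ns, m) \<in> weighted_params t n. all_proper ns m} = proper_params t n"
    using assms by (auto simp: weighted_params_def proper_params_def admissible_iff)
  then have "{W \<in> weighted_games n t 1. nontrivial_game {1..n} W} =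
      vector_games {1..n} (proper_params t n)"
    unfolding weighted_games_unique_shift_minimal
    by (subst nontrivial_vector_games) (auto simp: weighted_params_def)
  moreover have "card (vector_games {1..n} (proper_params t n) // game_iso {1..n}) =
      card (proper_params t n)"
    using assms by (intro card_vector_games_quotient) (auto simp: proper_params_def admissible_iff)
  ultimately show ?thesis by (simp add: wg_hat_def)
qed

subsection \<open>Counting\<close>

definition add_class :: "(nat \<Rightarrow> 'a \<Rightarrow> 'b) \<Rightarrow> (nat \<Rightarrow> 'a set) \<Rightarrow> nat \<Rightarrow> 'b set" where
  "add_class g F n = (\<Union>a\<in>{1..n}. g a ` F (n - a))"

lemma mem_add_class:
  "p \<in> add_class g F n \<longleftrightarrow> (\<exists>a x. 0 < a \<and> a \<le> n \<and> x \<in> F (n - a) \<and> p = g a x)"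
  by (auto simp: add_class_def Suc_le_eq)

lemma card_add_class:
  assumes inj: "\<And>a x b y. g a x = g b y \<Longrightarrow> a = b \<and> x = y" and fin: "\<And>k. finite (F k)"
  shows "finite (add_class g F n)" and "card (add_class g F n) = (\<Sum>k<n. card (F k))"
proof -
  have image: "add_class g F n = (\<lambda>(a, x). g a x) ` (SIGMA a:{1..n}. F (n - a))"
    by (auto simp: add_class_def)
  show "finite (add_class g F n)" unfolding add_class_def using fin by auto
  have "inj_on (\<lambda>(a, x). g a x) (SIGMA a:{1..n}. F (n - a))" using inj by (auto simp: inj_on_def)
  then have "card (add_class g F n) = (\<Sum>a\<in>{1..n}. card (F (n - a)))"
    unfolding image using fin by (simp add: card_image)
  also have "\<dots> = (\<Sum>k<n. card (F k))"
    by (rule sum.reindex_bij_witness[of _ "\<lambda>k. n - k" "\<lambda>a. n - a"]) auto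
  finally show "card (add_class g F n) = (\<Sum>k<n. card (F k))" .
qed

definition add_veto :: "(nat \<Rightarrow> (nat list \<times> nat list) set) \<Rightarrow> nat \<Rightarrow> (nat list \<times> nat list) set" where
  "add_veto = add_class (\<lambda>a. map_prod ((#) a) ((#) a))"

definition add_null :: "(nat \<Rightarrow> (nat list \<times> nat list) set) \<Rightarrow> nat \<Rightarrow> (nat list \<times> nat list) set" where
  "add_null = add_class (\<lambda>b. map_prod (\<lambda>ns. ns @ [b]) (\<lambda>m. m @ [0]))"

lemma mem_add_veto:
  "(ns, m) \<in> add_veto F n \<longleftrightarrow>
     (\<exists>a ns' m'. 0 < a \<and> a \<le> n \<and> (ns', m') \<in> F (n - a) \<and> ns = a # ns' \<and> m = a # m')"
  by (auto simp: add_veto_def mem_add_class)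

lemma mem_add_null:
  "(ns, m) \<in> add_null F n \<longleftrightarrow>
     (\<exists>b ns' m'. 0 < b \<and> b \<le> n \<and> (ns', m') \<in> F (n - b) \<and> ns = ns' @ [b] \<and> m = m' @ [0])"
  by (auto simp: add_null_def mem_add_class)

lemma card_add_veto:
  assumes "\<And>k. finite (F k)"
  shows "finite (add_veto F n)" and "card (add_veto F n) = (\<Sum>k<n. card (F k))"
  unfolding add_veto_def by (rule card_add_class; use assms in auto)+

lemma card_add_null:
  assumes "\<And>k. finite (F k)"
  shows "finite (add_null F n)" and "card (add_null F n) = (\<Sum>k<n. card (F k))"
  unfolding add_null_def by (rule card_add_class; use assms in auto)+

lemma sum_diff_choose:
  assumes "0 < r"
  shows "(\<Sum>k<n. (k - s) choose r) = (n - s) choose Suc r"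
proof (induction n)
  case (Suc n)
  then show ?case using assms by (cases "s \<le> n") (auto simp: Suc_diff_le gr0_conv_Suc)
qed simp

lemma proper_params_0: "proper_params 0 n = (if n = 0 then {([], [])} else {})"
  by (auto simp: proper_params_def trade_free_if_length_le_1)

lemma proper_params_1: "proper_params (Suc 0) n = (\<lambda>c. ([n], [c])) ` {1..<n}"
proof -
  have "(ns, m) \<in> proper_params (Suc 0) n \<longleftrightarrow> ns = [n] \<and> (\<exists>c. m = [c] \<and> 0 < c \<and> c < n)" for ns m
    by (auto simp: proper_params_def trade_free_if_length_le_1 length_Suc_conv all_proper_Cons1)
  then show ?thesis by auto
qed

lemma mem_proper_params_2:
  "p \<in> proper_params 2 n \<longleftrightarrow> (\<exists>a b c d. p = ([a, b], [c, d]) \<and> a + b = n \<and>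
     0 < c \<and> c < a \<and> 0 < d \<and> d < b \<and> (d = 1 \<or> Suc d = b))"
  by (cases p) (auto simp: proper_params_def numeral_2_eq_2 length_Suc_conv all_proper_Cons1
      trade_free_pair)

text \<open>
  The conditions \<open>m\<^sub>2 = 1\<close> and \<open>m\<^sub>2 = ns\<^sub>2 - 1\<close> coincide for \<open>ns\<^sub>2 = 2\<close>, so the second set starts at
  \<open>ns\<^sub>2 = 3\<close>.
\<close>

lemma proper_params_2:
  "proper_params 2 n =
     add_class (\<lambda>b. map_prod (\<lambda>ns. ns @ [b + 1]) (\<lambda>m. m @ [1])) (proper_params (Suc 0)) (n - 1) \<union>
     add_class (\<lambda>b. map_prod (\<lambda>ns. ns @ [b + 2]) (\<lambda>m. m @ [b + 1])) (proper_params (Suc 0)) (n - 2)"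
    (is "_ = ?one \<union> ?all_but_one")
proof (intro equalityI subsetI)
  fix p assume "p \<in> proper_params 2 n"
  then obtain a b c d where p: "p = ([a, b], [c, d])" "a + b = n" "0 < c" "c < a" "0 < d" "d < b"
    and "d = 1 \<or> d \<noteq> 1 \<and> Suc d = b" by (auto simp: mem_proper_params_2)
  from this(7) show "p \<in> ?one \<union> ?all_but_one"
  proof (elim disjE conjE)
    assume "d = 1"
    with p have "p \<in> ?one"
      unfolding mem_add_class proper_params_1
      by (intro exI[of _ "b - 1"] exI[of _ "([a], [c])"]) auto
    then show ?thesis ..
  next
    assume "d \<noteq> 1" "Suc d = b"
    with p have "p \<in> ?all_but_one"
      unfolding mem_add_class proper_params_1
      by (intro exI[of _ "d - 1"] exI[of _ "([a], [c])"]) auto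
    then show ?thesis ..
  qed
qed (auto simp: mem_add_class mem_proper_params_2 proper_params_1)

lemma proper_params_ge_3: "3 \<le> t \<Longrightarrow> proper_params t n = {}"
  using all_proper_trade_free_length by (fastforce simp: proper_params_def)

lemma card_proper_params_1:
  "finite (proper_params (Suc 0) n)" "card (proper_params (Suc 0) n) = n - 1"
  unfolding proper_params_1 by (simp, subst card_image) (auto simp: inj_on_def)

lemma sum_card_proper_params_1:
  "(\<Sum>k<n. card (proper_params (Suc 0) k)) = (n - 1) choose 2"
  using sum_diff_choose[of 1 1 n] by (simp add: card_proper_params_1 numeral_2_eq_2)

lemma card_proper_params_2:
  "finite (proper_params 2 n)" "card (proper_params 2 n) = ((n - 2) choose 2) + ((n - 3) choose 2)"
proof -
  let ?one = "add_class (\<lambda>b. map_prod (\<lambda>ns. ns @ [b + 1]) (\<lambda>m. m @ [1]))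
      (proper_params (Suc 0)) (n - 1)"
    and ?all_but_one = "add_class (\<lambda>b. map_prod (\<lambda>ns. ns @ [b + 2]) (\<lambda>m. m @ [b + 1]))
      (proper_params (Suc 0)) (n - 2)"
  have "finite ?one" "card ?one = (\<Sum>k<n - 1. card (proper_params (Suc 0) k))"
    "finite ?all_but_one" "card ?all_but_one = (\<Sum>k<n - 2. card (proper_params (Suc 0) k))"
    by (rule card_add_class; auto simp: card_proper_params_1)+
  moreover have "?one \<inter> ?all_but_one = {}" by (auto simp: mem_add_class)
  ultimately show "finite (proper_params 2 n)"
    "card (proper_params 2 n) = ((n - 2) choose 2) + ((n - 3) choose 2)"
    unfolding proper_params_2 sum_card_proper_params_1
    by (simp_all add: card_Un_disjoint eval_nat_numeral)
qed

lemma finite_proper_params: "finite (proper_params t n)"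
proof -
  consider "t = 0" | "t = Suc 0" | "t = 2" | "3 \<le> t" by linarith
  then show ?thesis
    by cases (simp_all add: proper_params_0 card_proper_params_1 card_proper_params_2
        proper_params_ge_3)
qed

lemma weighted_params_iff:
  "(ns, m) \<in> weighted_params t n \<longleftrightarrow>
     0 < t \<and> (ns, m) \<in> proper_params t n \<or>
     (\<exists>s. t = Suc s \<and> (ns, m) \<in> add_veto (proper_params s) n) \<or>
     (\<exists>s. t = Suc s \<and> 0 < s \<and> (ns, m) \<in> add_null (proper_params s) n) \<or>
     (\<exists>s. t = Suc (Suc s) \<and> (ns, m) \<in> add_veto (add_null (proper_params s)) n)"
  by (auto simp: weighted_params_def proper_params_def admissible_iff mem_add_veto mem_add_null
      trade_free_veto trade_free_null all_proper_length)

lemma sum_card_proper_params_0: "(\<Sum>k<n. card (proper_params 0 k)) = of_bool (0 < n)"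
  by (induction n) (auto simp: proper_params_0)

lemma card_weighted_params_1: "card (weighted_params (Suc 0) n) = (n - 1) + of_bool (0 < n)"
proof -
  have "weighted_params (Suc 0) n = proper_params (Suc 0) n \<union> add_veto (proper_params 0) n"
    by (auto simp: weighted_params_iff)
  moreover have "proper_params (Suc 0) n \<inter> add_veto (proper_params 0) n = {}"
    by (auto simp: proper_params_1 mem_add_veto)
  ultimately show ?thesis
    by (simp add: card_Un_disjoint finite_proper_params card_add_veto card_proper_params_1
        sum_card_proper_params_0)
qed

lemma card_weighted_params_Suc_Suc:
  "card (weighted_params (Suc (Suc t)) n) =
     card (proper_params (Suc (Suc t)) n) + 2 * (\<Sum>k<n. card (proper_params (Suc t) k)) +
     (\<Sum>k<n. \<Sum>j<k. card (proper_params t j))"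
proof -
  let ?A = "proper_params (Suc (Suc t)) n" and ?B = "add_veto (proper_params (Suc t)) n"
    and ?C = "add_null (proper_params (Suc t)) n" and ?D = "add_veto (add_null (proper_params t)) n"
  define veto null :: "nat list \<times> nat list \<Rightarrow> bool"
    where "veto p \<longleftrightarrow> hd (snd p) = hd (fst p)" and "null p \<longleftrightarrow> 0 \<in> set (snd p)" for p
  have "\<forall>p\<in>?A. \<not> veto p \<and> \<not> null p" "\<forall>p\<in>?B. veto p \<and> \<not> null p"
    "\<forall>p\<in>?C. \<not> veto p \<and> null p" "\<forall>p\<in>?D. veto p \<and> null p"
    by (fastforce simp: veto_def null_def proper_params_def mem_add_veto mem_add_null
        length_Suc_conv all_proper_Cons1 dest: all_proper_0_notin)+
  then have "?A \<inter> ?B = {}" "?C \<inter> ?D = {}" "(?A \<union> ?B) \<inter> (?C \<union> ?D) = {}" by blast+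
  moreover have "finite ?A" "finite ?B" "finite ?C" "finite ?D"
    by (simp_all add: finite_proper_params card_add_veto card_add_null)
  moreover have "weighted_params (Suc (Suc t)) n = (?A \<union> ?B) \<union> (?C \<union> ?D)"
    by (auto simp: weighted_params_iff)
  ultimately have
    "card (weighted_params (Suc (Suc t)) n) = (card ?A + card ?B) + (card ?C + card ?D)"
    by (simp add: card_Un_disjoint)
  then show ?thesis by (simp add: finite_proper_params card_add_veto card_add_null)
qed

lemma wg_one_class:
  assumes "0 < n"
  shows "wg n 1 1 = n"
  unfolding wg_eq_card_weighted_params using card_weighted_params_1[of n] assms by simp

lemma wg_two_classes:
  "wg n 2 1 = ((n - 2) choose 2) + ((n - 3) choose 2) + 2 * ((n - 1) choose 2) + (n - 1)"
proof -
  have "(\<Sum>k<n. \<Sum>j<k. card (proper_params 0 j)) = n - 1"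
    unfolding sum_card_proper_params_0 by (induction n) auto
  then have
    "card (weighted_params 2 n) = card (proper_params 2 n) + 2 * ((n - 1) choose 2) + (n - 1)"
    using card_weighted_params_Suc_Suc[of 0 n]
    by (simp only: sum_card_proper_params_1 numeral_2_eq_2)
  then show ?thesis unfolding wg_eq_card_weighted_params card_proper_params_2 by simp
qed

lemma sum_card_proper_params_2:
  "(\<Sum>k<n. card (proper_params 2 k)) = ((n - 2) choose 3) + ((n - 3) choose 3)"
  using sum_diff_choose[of 2 2 n] sum_diff_choose[of 2 3 n]
  by (simp add: card_proper_params_2 sum.distrib)

lemma wg_three_classes:
  "wg n 3 1 = 2 * (((n - 2) choose 3) + ((n - 3) choose 3)) + ((n - 1) choose 3)"
proof -
  have "(\<Sum>k<n. \<Sum>j<k. card (proper_params (Suc 0) j)) = (n - 1) choose 3"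
    unfolding sum_card_proper_params_1 using sum_diff_choose[of 2 1 n] by simp
  then show ?thesis
    unfolding wg_eq_card_weighted_params
    using card_weighted_params_Suc_Suc[of 1 n] sum_card_proper_params_2[of n]
    by (simp add: proper_params_ge_3 eval_nat_numeral)
qed

lemma wg_four_classes: "wg n 4 1 = ((n - 2) choose 4) + ((n - 3) choose 4)"
proof -
  have "(\<Sum>k<n. \<Sum>j<k. card (proper_params 2 j)) = ((n - 2) choose 4) + ((n - 3) choose 4)"
    unfolding sum_card_proper_params_2 sum.distrib
    using sum_diff_choose[of 3 2 n] sum_diff_choose[of 3 3 n] by simp
  then show ?thesis
    unfolding wg_eq_card_weighted_params
    using card_weighted_params_Suc_Suc[of 2 n] by (simp add: proper_params_ge_3)
qed

lemma wg_ge_five_classes: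
  assumes "5 \<le> t"
  shows "wg n t 1 = 0"
proof -
  obtain s where "t = 5 + s" using assms le_Suc_ex by blast
  then show ?thesis
    unfolding wg_eq_card_weighted_params
    using card_weighted_params_Suc_Suc[of "3 + s" n] by (simp add: proper_params_ge_3)
qed

lemma wg_hat_one_class: "wg_hat n 1 1 = n - 1"
  using wg_hat_eq_card_proper_params[of 1 n] by (simp add: card_proper_params_1)

lemma wg_hat_two_classes: "wg_hat n 2 1 = ((n - 2) choose 2) + ((n - 3) choose 2)"
  using wg_hat_eq_card_proper_params[of 2 n] by (simp add: card_proper_params_2)

lemma wg_hat_ge_three_classes: "3 \<le> t \<Longrightarrow> wg_hat n t 1 = 0"
  using wg_hat_eq_card_proper_params[of t n] by (simp add: proper_params_ge_3)

lemma real_choose_2: "real (k choose 2) = real k * (real k - 1) / 2"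
  and real_choose_3: "real (k choose 3) = real k * (real k - 1) * (real k - 2) / 6"
  and real_choose_4: "real (k choose 4) = real k * (real k - 1) * (real k - 2) * (real k - 3) / 24"
  by (simp_all add: binomial_gbinomial gbinomial_prod_rev eval_nat_numeral)

lemma real_wg_hat_two_classes: "3 \<le> n \<Longrightarrow> real (wg_hat n 2 1) = real n ^ 2 - 6 * real n + 9"
  unfolding wg_hat_two_classes by (simp add: real_choose_2 field_simps power2_eq_square)

lemma real_wg_two_classes: "3 \<le> n \<Longrightarrow> real (wg n 2 1) = 2 * (real n - 2) ^ 2 + 2"
  unfolding wg_two_classes by (simp add: real_choose_2 field_simps power2_eq_square)

lemma real_wg_three_classes:
  "3 \<le> n \<Longrightarrow> real (wg n 3 1) = (5 * real n ^ 3 - 48 * real n ^ 2 + 157 * real n - 174) / 6"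
  unfolding wg_three_classes
  by (simp add: real_choose_3 field_simps power2_eq_square power3_eq_cube)

lemma real_wg_four_classes:
  "3 \<le> n \<Longrightarrow> real (wg n 4 1) =
     (real n ^ 4 - 16 * real n ^ 3 + 95 * real n ^ 2 - 248 * real n + 240) / 12"
  unfolding wg_four_classes
  by (simp add: real_choose_4 field_simps power2_eq_square power3_eq_cube
      power4_eq_xxxx)

theorem theorem3p3:
  fixes n :: nat
  assumes "n \<ge> 1"
  shows "real (wg_hat n 1 1) = real n - 1
    \<and> (n \<le> 2 \<longrightarrow> wg_hat n 2 1 = 0)
    \<and> (n \<ge> 3 \<longrightarrow> real (wg_hat n 2 1) = real n ^ 2 - 6 * real n + 9)
    \<and> (\<forall>t\<ge>3. wg_hat n t 1 = 0)
    \<and> wg n 1 1 = n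
    \<and> (n \<le> 2 \<longrightarrow> real (wg n 2 1) = real n - 1)
    \<and> (n \<ge> 3 \<longrightarrow> real (wg n 2 1) = 2 * (real n - 2) ^ 2 + 2)
    \<and> (n \<le> 3 \<longrightarrow> wg n 3 1 = 0)
    \<and> (n \<ge> 4 \<longrightarrow> real (wg n 3 1) =
          (5 * real n ^ 3 - 48 * real n ^ 2 + 157 * real n - 174) / 6)
    \<and> (n \<le> 5 \<longrightarrow> wg n 4 1 = 0)
    \<and> (n \<ge> 6 \<longrightarrow> real (wg n 4 1) =
          (real n ^ 4 - 16 * real n ^ 3 + 95 * real n ^ 2 - 248 * real n + 240) / 12)
    \<and> (\<forall>t\<ge>5. wg n t 1 = 0)"
proof (intro conjI allI impI)
  show "real (wg_hat n 1 1) = real n - 1" unfolding wg_hat_one_class using assms by simp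
  show "wg_hat n 2 1 = 0" if "n \<le> 2" unfolding wg_hat_two_classes using that by simp
  show "wg n 1 1 = n" using assms by (intro wg_one_class) simp
  show "real (wg n 2 1) = real n - 1" if "n \<le> 2"
    unfolding wg_two_classes using that assms by (simp add: binomial_eq_0)
  show "wg n 3 1 = 0" if "n \<le> 3" unfolding wg_three_classes using that by (simp, arith)
  show "wg n 4 1 = 0" if "n \<le> 5" unfolding wg_four_classes using that by (simp, arith)
  show "real (wg n 3 1) = (5 * real n ^ 3 - 48 * real n ^ 2 + 157 * real n - 174) / 6"
    if "n \<ge> 4" using that by (intro real_wg_three_classes) simp
  show "real (wg n 4 1) =
      (real n ^ 4 - 16 * real n ^ 3 + 95 * real n ^ 2 - 248 * real n + 240) / 12"
    if "n \<ge> 6" using that by (intro real_wg_four_classes) simp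
qed (rule real_wg_hat_two_classes real_wg_two_classes wg_hat_ge_three_classes wg_ge_five_classes;
    assumption)+

end
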